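(* Let $\mathsf{C}$ be a category. For all semigroups $G_1$ and $G_2$ (with identity), the restriction functor $R:\mathsf{C}_{G_1*G_2}\to\mathsf{C}_{G_1}\times\mathsf{C}_{G_2}$, which restricts an action of $G_1*G_2$ on $\mathsf{C}$ to $G_1$ and to $G_2$, and restricts a morphism $\{m_f\mid f\in G_1*G_2\}$ to $(\{m_f\mid f\in G_1\},\{m_f\mid f\in G_2\})$, is an equivalence of categories.
   Context: Semigroups have an identity element $e$, semigroup homomorphisms preserve identities, and $G_1*G_2$ is the free product of semigroups. For a semigroup $G$ and a category $\mathsf{C}$, $\mathsf{C}_G$ is the category of $G$-actions on $\mathsf{C}$. An object consists of functors $T(g):\mathsf{C}\to\mathsf{C}$ ($g\in G$), isomorphisms of functors $c_{f,g}:T(f)\circ T(g)\to T(fg)$ ($f,g\in G$) and an isomorphism of functors $\iota:T(e)\to\mathrm{id}_{\mathsf{C}}$ such that for all $f,g,h\in G$: $c_{fg,h}\,(c_{f,g}\circ\mathrm{id}_{T(h)})=c_{f,gh}\,(\mathrm{id}_{T(f)}\circ c_{g,h})$. (Here $\circ$ between morphisms of functors is horizontal composition and juxtaposition is vertical composition.) A morphism from $T$ (with isomorphisms $c_{f,g}$) to $T'$ (with isomorphisms $c'_{f,g}$) is a family of morphisms of functors $m_f:T(f)\to T'(f)$ ($f\in G$) with $m_{fg}\,c_{f,g}=c'_{f,g}\,(m_f\circ m_g)$ for all $f,g\in G$. $\mathsf{C}_{G_1}\times\mathsf{C}_{G_2}$ is the product category. On objects, $R$ sends an action of $G_1*G_2$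 to the pair whose $l$-th component ($l=1,2$) consists of the functors $T(g)$, $g\in G_l$, and the isomorphisms $c_{f,g}$, $f,g\in G_l$ (with the same $\iota$).
   Formalization: Morphisms of actions are additionally required to have m_e an isomorphism of functors; without this R is not full (e.g. trivial G_1, G_2 and a category whose identity functor has a nontrivial idempotent endomorphism). *)

theory Defs
  imports "HOL-Library.FuncSet" "HOL-Algebra.Group"
begin

section \<open>Categories, functors, morphisms of functors\<close>

record ('o, 'm) cat =
  Obj :: "'o set"
  Arr :: "'m set"
  Dom :: "'m \<Rightarrow> 'o"
  Cod :: "'m \<Rightarrow> 'o"
  Ident :: "'o \<Rightarrow> 'm"
  Comp :: "'m \<Rightarrow> 'm \<Rightarrow> 'm"

definition Hom :: "('o, 'm) cat \<Rightarrow> 'o \<Rightarrow> 'o \<Rightarrow> 'm set"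
  where "Hom C x y = {f \<in> Arr C. Dom C f = x \<and> Cod C f = y}"

text \<open>Composition is in applicative order: \<open>Comp C g f\<close> is ``\<open>g\<close> after \<open>f\<close>''.\<close>

definition is_category :: "('o, 'm) cat \<Rightarrow> bool"
  where "is_category C \<longleftrightarrow>
    (\<forall>f\<in>Arr C. Dom C f \<in> Obj C \<and> Cod C f \<in> Obj C) \<and>
    (\<forall>x\<in>Obj C. Ident C x \<in> Hom C x x) \<and>
    (\<forall>x\<in>Obj C. \<forall>y\<in>Obj C. \<forall>z\<in>Obj C. \<forall>f\<in>Hom C x y. \<forall>g\<in>Hom C y z.
       Comp C g f \<in> Hom C x z) \<and>
    (\<forall>x\<in>Obj C. \<forall>y\<in>Obj C. \<forall>f\<in>Hom C x y.
       Comp C f (Ident C x) = f \<and> Comp C (Ident C y) f = f) \<and>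
    (\<forall>w\<in>Obj C. \<forall>x\<in>Obj C. \<forall>y\<in>Obj C. \<forall>z\<in>Obj C.
       \<forall>f\<in>Hom C w x. \<forall>g\<in>Hom C x y. \<forall>h\<in>Hom C y z.
       Comp C (Comp C h g) f = Comp C h (Comp C g f))"

text \<open>Functors, morphisms of functors and families indexed by a semigroup are \<open>extensional\<close>
  functions, so that equality in HOL is equality of the mathematical objects.\<close>

record ('o, 'm, 'p, 'n) cfunctor =
  fobj :: "'o \<Rightarrow> 'p"
  farr :: "'m \<Rightarrow> 'n"

definition is_functor :: "('o, 'm) cat \<Rightarrow> ('p, 'n) cat \<Rightarrow> ('o, 'm, 'p, 'n) cfunctor \<Rightarrow> bool"
  where "is_functor A B F \<longleftrightarrow>
    is_category A \<and> is_category B \<and>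
    fobj F \<in> Obj A \<rightarrow>\<^sub>E Obj B \<and>
    farr F \<in> Arr A \<rightarrow>\<^sub>E Arr B \<and>
    (\<forall>x\<in>Obj A. \<forall>y\<in>Obj A. \<forall>f\<in>Hom A x y. farr F f \<in> Hom B (fobj F x) (fobj F y)) \<and>
    (\<forall>x\<in>Obj A. farr F (Ident A x) = Ident B (fobj F x)) \<and>
    (\<forall>x\<in>Obj A. \<forall>y\<in>Obj A. \<forall>z\<in>Obj A. \<forall>f\<in>Hom A x y. \<forall>g\<in>Hom A y z.
       farr F (Comp A g f) = Comp B (farr F g) (farr F f))"

definition id_functor :: "('o, 'm) cat \<Rightarrow> ('o, 'm, 'o, 'm) cfunctor"
  where "id_functor A = \<lparr>fobj = (\<lambda>x\<in>Obj A. x), farr = (\<lambda>f\<in>Arr A. f)\<rparr>"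

text \<open>\<open>comp_functor A G F\<close> is the composite \<open>G \<circ> F\<close> of functors, with \<open>A\<close> the domain of \<open>F\<close>.\<close>

definition comp_functor ::
    "('o, 'm) cat \<Rightarrow> ('p, 'n, 'q, 'k) cfunctor \<Rightarrow> ('o, 'm, 'p, 'n) cfunctor
      \<Rightarrow> ('o, 'm, 'q, 'k) cfunctor"
  where "comp_functor A G F =
    \<lparr>fobj = (\<lambda>x\<in>Obj A. fobj G (fobj F x)), farr = (\<lambda>f\<in>Arr A. farr G (farr F f))\<rparr>"

definition is_nat_trans ::
    "('o, 'm) cat \<Rightarrow> ('p, 'n) cat \<Rightarrow> ('o, 'm, 'p, 'n) cfunctor \<Rightarrow> ('o, 'm, 'p, 'n) cfunctor
      \<Rightarrow> ('o \<Rightarrow> 'n) \<Rightarrow> bool"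
  where "is_nat_trans A B F G \<alpha> \<longleftrightarrow>
    is_functor A B F \<and> is_functor A B G \<and>
    \<alpha> \<in> extensional (Obj A) \<and>
    (\<forall>x\<in>Obj A. \<alpha> x \<in> Hom B (fobj F x) (fobj G x)) \<and>
    (\<forall>x\<in>Obj A. \<forall>y\<in>Obj A. \<forall>f\<in>Hom A x y.
       Comp B (\<alpha> y) (farr F f) = Comp B (farr G f) (\<alpha> x))"

definition id_nat :: "('o, 'm) cat \<Rightarrow> ('p, 'n) cat \<Rightarrow> ('o, 'm, 'p, 'n) cfunctor \<Rightarrow> 'o \<Rightarrow> 'n"
  where "id_nat A B F = (\<lambda>x\<in>Obj A. Ident B (fobj F x))"

definition vcomp :: "('o, 'm) cat \<Rightarrow> ('p, 'n) cat \<Rightarrow> ('o \<Rightarrow> 'n) \<Rightarrow> ('o \<Rightarrow> 'n) \<Rightarrow> 'o \<Rightarrow> 'n"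
  where "vcomp A B \<beta> \<alpha> = (\<lambda>x\<in>Obj A. Comp B (\<beta> x) (\<alpha> x))"

text \<open>For \<open>\<alpha> : F \<rightarrow> F'\<close> between functors with domain \<open>A\<close>, and \<open>\<beta> : H \<rightarrow> H'\<close> between functors with
  codomain \<open>D\<close>, \<open>hcomp A D H F' \<beta> \<alpha>\<close> is the horizontal composite \<open>H \<circ> F \<rightarrow> H' \<circ> F'\<close>.\<close>

definition hcomp ::
    "('o, 'm) cat \<Rightarrow> ('q, 'k) cat \<Rightarrow> ('p, 'n, 'q, 'k) cfunctor \<Rightarrow> ('o, 'm, 'p, 'n) cfunctor
      \<Rightarrow> ('p \<Rightarrow> 'k) \<Rightarrow> ('o \<Rightarrow> 'n) \<Rightarrow> 'o \<Rightarrow> 'k"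
  where "hcomp A D H F' \<beta> \<alpha> = (\<lambda>x\<in>Obj A. Comp D (\<beta> (fobj F' x)) (farr H (\<alpha> x)))"

definition is_nat_iso ::
    "('o, 'm) cat \<Rightarrow> ('p, 'n) cat \<Rightarrow> ('o, 'm, 'p, 'n) cfunctor \<Rightarrow> ('o, 'm, 'p, 'n) cfunctor
      \<Rightarrow> ('o \<Rightarrow> 'n) \<Rightarrow> bool"
  where "is_nat_iso A B F G \<alpha> \<longleftrightarrow>
    is_nat_trans A B F G \<alpha> \<and>
    (\<exists>\<beta>. is_nat_trans A B G F \<beta> \<and>
         vcomp A B \<beta> \<alpha> = id_nat A B F \<and> vcomp A B \<alpha> \<beta> = id_nat A B G)"

definition is_equivalence :: "('o, 'm) cat \<Rightarrow> ('p, 'n) cat \<Rightarrow> ('o, 'm, 'p, 'n) cfunctor \<Rightarrow> bool"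
  where "is_equivalence A B F \<longleftrightarrow>
    is_functor A B F \<and>
    (\<exists>G. is_functor B A G \<and>
         (\<exists>\<eta>. is_nat_iso A A (id_functor A) (comp_functor A G F) \<eta>) \<and>
         (\<exists>\<epsilon>. is_nat_iso B B (comp_functor B F G) (id_functor B) \<epsilon>))"

definition prod_cat :: "('o, 'm) cat \<Rightarrow> ('p, 'n) cat \<Rightarrow> ('o \<times> 'p, 'm \<times> 'n) cat"
  where "prod_cat A B =
    \<lparr>Obj = Obj A \<times> Obj B,
     Arr = Arr A \<times> Arr B,
     Dom = (\<lambda>(f, g). (Dom A f, Dom B g)),
     Cod = (\<lambda>(f, g). (Cod A f, Cod B g)),
     Ident = (\<lambda>(x, y). (Ident A x, Ident B y)),
     Comp = (\<lambda>(f', g') (f, g). (Comp A f' f, Comp B g' g))\<rparr>"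


section \<open>Free products of semigroups with identity\<close>

text \<open>Semigroups with identity are the \<open>monoid\<close>s of HOL-Algebra. Elements of the free product are
  reduced words: lists of non-identity letters taken alternately from \<open>G\<close> (tag \<open>Inl\<close>) and
  \<open>H\<close> (tag \<open>Inr\<close>); the empty word is the common identity.\<close>

definition reduced_words ::
    "('a, 'x) monoid_scheme \<Rightarrow> ('b, 'y) monoid_scheme \<Rightarrow> ('a + 'b) list set"
  where "reduced_words G H =
    {w. set w \<subseteq> (carrier G - {\<one>\<^bsub>G\<^esub>}) <+> (carrier H - {\<one>\<^bsub>H\<^esub>}) \<and>
        successively (\<lambda>x y. isl x \<noteq> isl y) w}"

text \<open>Left multiplication of a reduced word by a single non-identity letter. If the product of two
  adjacent letters is the identity, what remains is again reduced.\<close>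

fun letter_mult ::
    "('a, 'x) monoid_scheme \<Rightarrow> ('b, 'y) monoid_scheme \<Rightarrow> 'a + 'b \<Rightarrow> ('a + 'b) list \<Rightarrow> ('a + 'b) list"
  where
    "letter_mult G H (Inl a) (Inl a' # w) =
       (if a \<otimes>\<^bsub>G\<^esub> a' = \<one>\<^bsub>G\<^esub> then w else Inl (a \<otimes>\<^bsub>G\<^esub> a') # w)"
  | "letter_mult G H (Inr b) (Inr b' # w) =
       (if b \<otimes>\<^bsub>H\<^esub> b' = \<one>\<^bsub>H\<^esub> then w else Inr (b \<otimes>\<^bsub>H\<^esub> b') # w)"
  | "letter_mult G H x w = x # w"

definition free_prod ::
    "('a, 'x) monoid_scheme \<Rightarrow> ('b, 'y) monoid_scheme \<Rightarrow> ('a + 'b) list monoid"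
  where "free_prod G H =
    \<lparr>carrier = reduced_words G H,
     mult = (\<lambda>v w. foldr (letter_mult G H) v w),
     one = []\<rparr>"

definition in_left :: "('a, 'x) monoid_scheme \<Rightarrow> 'a \<Rightarrow> ('a + 'b) list"
  where "in_left G a = (if a = \<one>\<^bsub>G\<^esub> then [] else [Inl a])"

definition in_right :: "('b, 'y) monoid_scheme \<Rightarrow> 'b \<Rightarrow> ('a + 'b) list"
  where "in_right H b = (if b = \<one>\<^bsub>H\<^esub> then [] else [Inr b])"


section \<open>Actions of a semigroup on a category\<close>

record ('g, 'o, 'm) action =
  act :: "'g \<Rightarrow> ('o, 'm, 'o, 'm) cfunctor"
  mulc :: "'g \<times> 'g \<Rightarrow> 'o \<Rightarrow> 'm"
  unitc :: "'o \<Rightarrow> 'm"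

definition is_action :: "('o, 'm) cat \<Rightarrow> ('g, 'x) monoid_scheme \<Rightarrow> ('g, 'o, 'm) action \<Rightarrow> bool"
  where "is_action C G T \<longleftrightarrow>
    act T \<in> extensional (carrier G) \<and>
    mulc T \<in> extensional (carrier G \<times> carrier G) \<and>
    (\<forall>g\<in>carrier G. is_functor C C (act T g)) \<and>
    (\<forall>f\<in>carrier G. \<forall>g\<in>carrier G.
       is_nat_iso C C (comp_functor C (act T f) (act T g)) (act T (f \<otimes>\<^bsub>G\<^esub> g)) (mulc T (f, g))) \<and>
    is_nat_iso C C (act T \<one>\<^bsub>G\<^esub>) (id_functor C) (unitc T) \<and>
    (\<forall>f\<in>carrier G. \<forall>g\<in>carrier G. \<forall>h\<in>carrier G.
       vcomp C C (mulc T (f \<otimes>\<^bsub>G\<^esub> g, h))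
         (hcomp C C (comp_functor C (act T f) (act T g)) (act T h)
            (mulc T (f, g)) (id_nat C C (act T h))) =
       vcomp C C (mulc T (f, g \<otimes>\<^bsub>G\<^esub> h))
         (hcomp C C (act T f) (act T (g \<otimes>\<^bsub>G\<^esub> h))
            (id_nat C C (act T f)) (mulc T (g, h))))"

record ('g, 'o, 'm) action_mor =
  msrc :: "('g, 'o, 'm) action"
  mtgt :: "('g, 'o, 'm) action"
  mfam :: "'g \<Rightarrow> 'o \<Rightarrow> 'm"

text \<open>The last clause, invertibility of the component at the identity element, expresses that
  morphisms of actions preserve the identity; it is not a consequence of compatibility with the
  \<open>mulc\<close>. Transporting the \<open>mulc T (\<one>, \<one>)\<close> along the \<open>unitc T\<close> to \<open>id\<^sub>C\<close> and normalising,
  compatibility at \<open>(\<one>, \<one>)\<close> says only that \<open>mfam m \<one>\<close> is an idempotent \<open>p\<close> of the commutative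
  monoid of endomorphisms of \<open>id\<^sub>C\<close>, and \<open>p\<close> is the identity if and only if it is invertible. If
  \<open>p \<noteq> 1\<close> were allowed, a pair of morphisms of actions of \<open>G\<close> and \<open>H\<close> could have different
  \<open>p\<close>, hence not come from the free product, and restriction would not be full: for example for
  trivial \<open>G\<close> and \<open>H\<close> acting on the category of vector spaces, where \<open>p\<close> can be \<open>0\<close> or \<open>1\<close>.\<close>

definition is_action_mor ::
    "('o, 'm) cat \<Rightarrow> ('g, 'x) monoid_scheme \<Rightarrow> ('g, 'o, 'm) action_mor \<Rightarrow> bool"
  where "is_action_mor C G m \<longleftrightarrow>
    is_action C G (msrc m) \<and> is_action C G (mtgt m) \<and>
    mfam m \<in> extensional (carrier G) \<and>
    (\<forall>f\<in>carrier G. is_nat_trans C C (act (msrc m) f) (act (mtgt m) f) (mfam m f)) \<and>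
    (\<forall>f\<in>carrier G. \<forall>g\<in>carrier G.
       vcomp C C (mfam m (f \<otimes>\<^bsub>G\<^esub> g)) (mulc (msrc m) (f, g)) =
       vcomp C C (mulc (mtgt m) (f, g))
         (hcomp C C (act (msrc m) f) (act (mtgt m) g) (mfam m f) (mfam m g))) \<and>
    is_nat_iso C C (act (msrc m) \<one>\<^bsub>G\<^esub>) (act (mtgt m) \<one>\<^bsub>G\<^esub>) (mfam m \<one>\<^bsub>G\<^esub>)"

definition action_cat ::
    "('o, 'm) cat \<Rightarrow> ('g, 'x) monoid_scheme
      \<Rightarrow> (('g, 'o, 'm) action, ('g, 'o, 'm) action_mor) cat"
  where "action_cat C G =
    \<lparr>Obj = {T. is_action C G T},
     Arr = {m. is_action_mor C G m},
     Dom = msrc,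
     Cod = mtgt,
     Ident = (\<lambda>T. \<lparr>msrc = T, mtgt = T, mfam = (\<lambda>f\<in>carrier G. id_nat C C (act T f))\<rparr>),
     Comp = (\<lambda>n m. \<lparr>msrc = msrc m, mtgt = mtgt n,
                    mfam = (\<lambda>f\<in>carrier G. vcomp C C (mfam n f) (mfam m f))\<rparr>)\<rparr>"

definition restrict_action ::
    "('g, 'x) monoid_scheme \<Rightarrow> ('g \<Rightarrow> 'h) \<Rightarrow> ('h, 'o, 'm) action \<Rightarrow> ('g, 'o, 'm) action"
  where "restrict_action G i T =
    \<lparr>act = (\<lambda>g\<in>carrier G. act T (i g)),
     mulc = (\<lambda>(f, g)\<in>carrier G \<times> carrier G. mulc T (i f, i g)),
     unitc = unitc T\<rparr>"

definition restrict_action_mor ::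
    "('g, 'x) monoid_scheme \<Rightarrow> ('g \<Rightarrow> 'h) \<Rightarrow> ('h, 'o, 'm) action_mor \<Rightarrow> ('g, 'o, 'm) action_mor"
  where "restrict_action_mor G i m =
    \<lparr>msrc = restrict_action G i (msrc m),
     mtgt = restrict_action G i (mtgt m),
     mfam = (\<lambda>g\<in>carrier G. mfam m (i g))\<rparr>"

definition restriction_functor ::
    "('o, 'm) cat \<Rightarrow> ('a, 'x) monoid_scheme \<Rightarrow> ('b, 'y) monoid_scheme
      \<Rightarrow> ((('a + 'b) list, 'o, 'm) action, (('a + 'b) list, 'o, 'm) action_mor,
          ('a, 'o, 'm) action \<times> ('b, 'o, 'm) action,
          ('a, 'o, 'm) action_mor \<times> ('b, 'o, 'm) action_mor) cfunctor"
  where "restriction_functor C G H =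
    \<lparr>fobj = (\<lambda>T\<in>Obj (action_cat C (free_prod G H)).
        (restrict_action G (in_left G) T, restrict_action H (in_right H) T)),
     farr = (\<lambda>m\<in>Arr (action_cat C (free_prod G H)).
        (restrict_action_mor G (in_left G) m, restrict_action_mor H (in_right H) m))\<rparr>"

end

theory Submission
  imports Defs
begin

text \<open>Restriction is shown to be fully faithful and essentially surjective. Every action is isomorphic
  to a normalised one, in which the identity acts by \<open>id\<^sub>C\<close> and all \<open>c\<^bsub>\<one>,g\<^esub>\<close>, \<open>c\<^bsub>g,\<one>\<^esub>\<close> are identities.
  Two normalised actions glue: a reduced word acts by the composite of its letters, and multiplying
  a word by a letter on the left uses the structure isomorphism of a single factor, so that coherence
  follows by induction on words. A morphism of actions of the free product is determined by its
  values on letters; conversely, compatibility of a family at three of the pairs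
  \<open>(f, g)\<close>, \<open>(g, h)\<close>, \<open>(f g, h)\<close>, \<open>(f, g h)\<close>, the first two among them, implies it at the fourth,
  which propagates compatibility from letters to all words.\<close>

section \<open>Isomorphisms and equivalences\<close>

text \<open>The two components of a restricted action share their functor at the identity e, their c
  at (e,e) and their iota, while an arbitrary pair of actions need not share any of them. So gluing
  works only up to isomorphism, after the discrepancy at e has been removed. No axiom ties iota to
  c: transport along iota makes T(e) equal to the identity functor, but c at (e,e) is then still
  some automorphism of it, which takes a second transport. For morphisms the obstacle is the value
  at e: compatibility makes it idempotent, and only its invertibility turns it into the identity, so
  that two morphisms to be glued agree at the empty word. The other obstacle is that a letter put
  before a reduced word may be appended, merged or cancelled. Case distinctions are avoided by
  admitting identity letters: every word is \<open>push y t\<close> with \<open>t\<close> not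
  starting in a given factor, and all three cases read
  \<open>push x (push y t) = push (lmul x y) t\<close>. Normalisation makes the identity letters
  harmless.\<close>

definition is_iso_arr :: "('o, 'm) cat \<Rightarrow> 'm \<Rightarrow> bool"
  where "is_iso_arr C f \<longleftrightarrow> f \<in> Arr C \<and>
    (\<exists>g\<in>Hom C (Cod C f) (Dom C f). Comp C g f = Ident C (Dom C f) \<and> Comp C f g = Ident C (Cod C f))"

definition inv_arr :: "('o, 'm) cat \<Rightarrow> 'm \<Rightarrow> 'm"
  where "inv_arr C f = (SOME g. g \<in> Hom C (Cod C f) (Dom C f) \<and>
    Comp C g f = Ident C (Dom C f) \<and> Comp C f g = Ident C (Cod C f))"

locale category =
  fixes C :: "('o, 'm) cat"
  assumes is_category: "is_category C"
begin

abbreviation cmp (infixr "\<cdot>" 70) where "g \<cdot> f \<equiv> Comp C g f"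

lemma dom_obj [simp]: "f \<in> Arr C \<Longrightarrow> Dom C f \<in> Obj C"
  and cod_obj [simp]: "f \<in> Arr C \<Longrightarrow> Cod C f \<in> Obj C"
  using is_category by (auto simp: is_category_def)

lemma ident_arr [simp]: "x \<in> Obj C \<Longrightarrow> Ident C x \<in> Arr C"
  and dom_ident [simp]: "x \<in> Obj C \<Longrightarrow> Dom C (Ident C x) = x"
  and cod_ident [simp]: "x \<in> Obj C \<Longrightarrow> Cod C (Ident C x) = x"
  using is_category by (auto simp: is_category_def Hom_def)

lemma comp_hom:
  assumes "f \<in> Arr C" "g \<in> Arr C" "Dom C g = Cod C f"
  shows "g \<cdot> f \<in> Hom C (Dom C f) (Cod C g)"
proof -
  have "f \<in> Hom C (Dom C f) (Cod C f)" "g \<in> Hom C (Cod C f) (Cod C g)"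
    using assms by (auto simp: Hom_def)
  then show ?thesis
    using is_category assms dom_obj cod_obj unfolding is_category_def by blast
qed

lemma comp_arr [simp]: "\<lbrakk>f \<in> Arr C; g \<in> Arr C; Dom C g = Cod C f\<rbrakk> \<Longrightarrow> g \<cdot> f \<in> Arr C"
  and dom_comp [simp]: "\<lbrakk>f \<in> Arr C; g \<in> Arr C; Dom C g = Cod C f\<rbrakk> \<Longrightarrow> Dom C (g \<cdot> f) = Dom C f"
  and cod_comp [simp]: "\<lbrakk>f \<in> Arr C; g \<in> Arr C; Dom C g = Cod C f\<rbrakk> \<Longrightarrow> Cod C (g \<cdot> f) = Cod C g"
  using comp_hom by (auto simp: Hom_def)

lemma comp_ident_right [simp]: "\<lbrakk>f \<in> Arr C; Dom C f = x\<rbrakk> \<Longrightarrow> f \<cdot> Ident C x = f"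
  and comp_ident_left [simp]: "\<lbrakk>f \<in> Arr C; Cod C f = x\<rbrakk> \<Longrightarrow> Ident C x \<cdot> f = f"
proof -
  have "f \<cdot> Ident C (Dom C f) = f \<and> Ident C (Cod C f) \<cdot> f = f" if "f \<in> Arr C"
  proof -
    have "f \<in> Hom C (Dom C f) (Cod C f)" using that by (simp add: Hom_def)
    then show ?thesis
      using is_category that dom_obj cod_obj unfolding is_category_def by blast
  qed
  then show "\<lbrakk>f \<in> Arr C; Dom C f = x\<rbrakk> \<Longrightarrow> f \<cdot> Ident C x = f"
    "\<lbrakk>f \<in> Arr C; Cod C f = x\<rbrakk> \<Longrightarrow> Ident C x \<cdot> f = f" by blast+
qed

lemma comp_assoc [simp]:
  assumes "f \<in> Arr C" "g \<in> Arr C" "h \<in> Arr C" "Dom C g = Cod C f" "Dom C h = Cod C g"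
  shows "(h \<cdot> g) \<cdot> f = h \<cdot> (g \<cdot> f)"
proof -
  have "f \<in> Hom C (Dom C f) (Cod C f)" "g \<in> Hom C (Cod C f) (Cod C g)"
    "h \<in> Hom C (Cod C g) (Cod C h)" using assms by (auto simp: Hom_def)
  then show ?thesis
    using is_category assms dom_obj cod_obj unfolding is_category_def by blast
qed

lemma
  assumes "is_iso_arr C f"
  shows inv_arr_arr [simp]: "inv_arr C f \<in> Arr C"
    and dom_inv_arr [simp]: "Dom C (inv_arr C f) = Cod C f"
    and cod_inv_arr [simp]: "Cod C (inv_arr C f) = Dom C f"
    and inv_arr_left [simp]: "inv_arr C f \<cdot> f = Ident C (Dom C f)"
    and inv_arr_right [simp]: "f \<cdot> inv_arr C f = Ident C (Cod C f)"
proof -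
  have "inv_arr C f \<in> Hom C (Cod C f) (Dom C f) \<and>
    inv_arr C f \<cdot> f = Ident C (Dom C f) \<and> f \<cdot> inv_arr C f = Ident C (Cod C f)"
    unfolding inv_arr_def
    by (rule someI_ex) (use assms in \<open>auto simp: is_iso_arr_def\<close>)
  then show "inv_arr C f \<in> Arr C" "Dom C (inv_arr C f) = Cod C f"
    "Cod C (inv_arr C f) = Dom C f" "inv_arr C f \<cdot> f = Ident C (Dom C f)"
    "f \<cdot> inv_arr C f = Ident C (Cod C f)"
    by (auto simp: Hom_def)
qed

lemma iso_arr [simp]: "is_iso_arr C f \<Longrightarrow> f \<in> Arr C"
  by (simp add: is_iso_arr_def)

text \<open>The simp rule \<open>comp_assoc\<close> nests composites to the right, where two
  mutually inverse arrows are usually followed by a tail; this form cancels them there.\<close>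

lemma inv_arr_left_assoc [simp]:
  assumes "is_iso_arr C f" "g \<in> Arr C" "Cod C g = Dom C f"
  shows "inv_arr C f \<cdot> f \<cdot> g = g"
  using assms comp_assoc[of g f "inv_arr C f"] by simp

lemma inv_arr_right_assoc [simp]:
  assumes "is_iso_arr C f" "g \<in> Arr C" "Cod C g = Cod C f"
  shows "f \<cdot> inv_arr C f \<cdot> g = g"
  using assms comp_assoc[of g "inv_arr C f" f] by simp

lemma is_iso_arrI:
  assumes "f \<in> Arr C" "g \<in> Arr C" "Dom C g = Cod C f" "Cod C g = Dom C f"
    "g \<cdot> f = Ident C (Dom C f)" "f \<cdot> g = Ident C (Cod C f)"
  shows "is_iso_arr C f"
  using assms unfolding is_iso_arr_def Hom_def by blast

lemma iso_inv_arr [simp]: "is_iso_arr C f \<Longrightarrow> is_iso_arr C (inv_arr C f)"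
  by (rule is_iso_arrI[where g = f]) auto

lemma iso_ident [simp]: "x \<in> Obj C \<Longrightarrow> is_iso_arr C (Ident C x)"
  by (rule is_iso_arrI[where g = "Ident C x"]) auto

lemma iso_comp [simp]:
  assumes "is_iso_arr C f" "is_iso_arr C g" "Dom C g = Cod C f"
  shows "is_iso_arr C (g \<cdot> f)"
  by (rule is_iso_arrI[where g = "inv_arr C f \<cdot> inv_arr C g"]) (use assms in auto)

lemma iso_cancel_right:
  assumes "is_iso_arr C f" "g \<in> Arr C" "h \<in> Arr C" "Dom C g = Cod C f" "Dom C h = Cod C f"
    "g \<cdot> f = h \<cdot> f"
  shows "g = h"
proof -
  have "(g \<cdot> f) \<cdot> inv_arr C f = (h \<cdot> f) \<cdot> inv_arr C f" using assms by simp
  then show ?thesis using assms(1-5) by simp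
qed

lemma iso_cancel_left:
  assumes "is_iso_arr C f" "g \<in> Arr C" "h \<in> Arr C" "Cod C g = Dom C f" "Cod C h = Dom C f"
    "f \<cdot> g = f \<cdot> h"
  shows "g = h"
proof -
  have "inv_arr C f \<cdot> f \<cdot> g = inv_arr C f \<cdot> f \<cdot> h" using assms by simp
  then show ?thesis using assms(1-5) by simp
qed

lemma inv_arr_unique:
  assumes "is_iso_arr C f" "g \<in> Arr C" "Dom C g = Cod C f" "Cod C g = Dom C f"
    "g \<cdot> f = Ident C (Dom C f)"
  shows "inv_arr C f = g"
  by (rule iso_cancel_right[OF assms(1)]) (use assms in auto)

end

section \<open>Functors and morphisms of functors, arrow by arrow\<close>

lemma functor_cat:
  assumes "is_functor A B F"
  shows "category A" "category B"
  using assms by (auto simp: is_functor_def category_def)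

lemma functor_obj: "is_functor A B F \<Longrightarrow> x \<in> Obj A \<Longrightarrow> fobj F x \<in> Obj B"
  by (auto simp: is_functor_def)

lemma functor_arr: "is_functor A B F \<Longrightarrow> f \<in> Arr A \<Longrightarrow> farr F f \<in> Arr B"
  by (auto simp: is_functor_def)

lemma functor_dom_cod:
  assumes "is_functor A B F" "f \<in> Arr A"
  shows "Dom B (farr F f) = fobj F (Dom A f)" "Cod B (farr F f) = fobj F (Cod A f)"
proof -
  interpret A: category A using functor_cat assms by blast
  have "f \<in> Hom A (Dom A f) (Cod A f)" using assms by (simp add: Hom_def)
  then have "farr F f \<in> Hom B (fobj F (Dom A f)) (fobj F (Cod A f))"
    using assms A.dom_obj A.cod_obj unfolding is_functor_def by blast
  then show "Dom B (farr F f) = fobj F (Dom A f)" "Cod B (farr F f) = fobj F (Cod A f)"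
    by (auto simp: Hom_def)
qed

lemma functor_ident: "is_functor A B F \<Longrightarrow> x \<in> Obj A \<Longrightarrow> farr F (Ident A x) = Ident B (fobj F x)"
  by (auto simp: is_functor_def)

lemma functor_comp:
  assumes "is_functor A B F" "f \<in> Arr A" "g \<in> Arr A" "Dom A g = Cod A f"
  shows "farr F (Comp A g f) = Comp B (farr F g) (farr F f)"
proof -
  interpret A: category A using functor_cat assms by blast
  have "f \<in> Hom A (Dom A f) (Cod A f)" "g \<in> Hom A (Cod A f) (Cod A g)"
    using assms by (auto simp add: Hom_def)
  then show ?thesis
    using assms A.dom_obj A.cod_obj unfolding is_functor_def by blast
qed

lemma functor_ext:
  assumes "is_functor A B F"
  shows "fobj F \<in> extensional (Obj A)" "farr F \<in> extensional (Arr A)"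
  using assms by (auto simp: is_functor_def PiE_def)

lemma is_functorI:
  assumes "is_category A" "is_category B"
    "fobj F \<in> extensional (Obj A)" "farr F \<in> extensional (Arr A)"
    "\<And>x. x \<in> Obj A \<Longrightarrow> fobj F x \<in> Obj B"
    "\<And>f. f \<in> Arr A \<Longrightarrow> farr F f \<in> Arr B"
    "\<And>f. f \<in> Arr A \<Longrightarrow> Dom B (farr F f) = fobj F (Dom A f)"
    "\<And>f. f \<in> Arr A \<Longrightarrow> Cod B (farr F f) = fobj F (Cod A f)"
    "\<And>x. x \<in> Obj A \<Longrightarrow> farr F (Ident A x) = Ident B (fobj F x)"
    "\<And>f g. f \<in> Arr A \<Longrightarrow> g \<in> Arr A \<Longrightarrow> Dom A g = Cod A f \<Longrightarrow>
       farr F (Comp A g f) = Comp B (farr F g) (farr F f)"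
  shows "is_functor A B F"
  using assms unfolding is_functor_def Hom_def by (auto simp: PiE_def)

lemma functor_iso:
  assumes "is_functor A B F" "is_iso_arr A f"
  shows "is_iso_arr B (farr F f)" and "inv_arr B (farr F f) = farr F (inv_arr A f)"
proof -
  interpret A: category A using functor_cat assms by blast
  interpret B: category B using functor_cat assms by blast
  note f = functor_arr[OF assms(1)] functor_dom_cod[OF assms(1)]
    functor_comp[OF assms(1), symmetric] functor_ident[OF assms(1)]
  show *: "is_iso_arr B (farr F f)"
    by (rule B.is_iso_arrI[where g = "farr F (inv_arr A f)"]) (use assms in \<open>auto simp: f\<close>)
  show "inv_arr B (farr F f) = farr F (inv_arr A f)"
    by (rule B.inv_arr_unique) (use assms * in \<open>auto simp: f\<close>)
qed

lemma nat_transI: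
  assumes "is_functor A B F" "is_functor A B G" "\<alpha> \<in> extensional (Obj A)"
    "\<And>x. x \<in> Obj A \<Longrightarrow> \<alpha> x \<in> Arr B"
    "\<And>x. x \<in> Obj A \<Longrightarrow> Dom B (\<alpha> x) = fobj F x"
    "\<And>x. x \<in> Obj A \<Longrightarrow> Cod B (\<alpha> x) = fobj G x"
    "\<And>f. f \<in> Arr A \<Longrightarrow> Comp B (\<alpha> (Cod A f)) (farr F f) = Comp B (farr G f) (\<alpha> (Dom A f))"
  shows "is_nat_trans A B F G \<alpha>"
  using assms unfolding is_nat_trans_def Hom_def by auto

lemma nat_trans_props:
  assumes "is_nat_trans A B F G \<alpha>"
  shows nat_trans_arr: "x \<in> Obj A \<Longrightarrow> \<alpha> x \<in> Arr B"
    and nat_trans_dom: "x \<in> Obj A \<Longrightarrow> Dom B (\<alpha> x) = fobj F x"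
    and nat_trans_cod: "x \<in> Obj A \<Longrightarrow> Cod B (\<alpha> x) = fobj G x"
    and nat_trans_natural:
      "f \<in> Arr A \<Longrightarrow> Comp B (\<alpha> (Cod A f)) (farr F f) = Comp B (farr G f) (\<alpha> (Dom A f))"
    and nat_trans_functors: "is_functor A B F" "is_functor A B G"
    and nat_trans_ext: "\<alpha> \<in> extensional (Obj A)"
proof -
  interpret A: category A using functor_cat assms unfolding is_nat_trans_def by blast
  show "x \<in> Obj A \<Longrightarrow> \<alpha> x \<in> Arr B" "x \<in> Obj A \<Longrightarrow> Dom B (\<alpha> x) = fobj F x"
    "x \<in> Obj A \<Longrightarrow> Cod B (\<alpha> x) = fobj G x"
    "f \<in> Arr A \<Longrightarrow> Comp B (\<alpha> (Cod A f)) (farr F f) = Comp B (farr G f) (\<alpha> (Dom A f))"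
    "is_functor A B F" "is_functor A B G" "\<alpha> \<in> extensional (Obj A)"
    using assms unfolding is_nat_trans_def Hom_def by auto
qed

text \<open>Inverting the components of a natural family gives a natural family, so invertibility
  can be tested object by object.\<close>

lemma is_nat_iso_iff:
  "is_nat_iso A B F G \<alpha> \<longleftrightarrow> is_nat_trans A B F G \<alpha> \<and> (\<forall>x\<in>Obj A. is_iso_arr B (\<alpha> x))"
proof (intro iffI conjI ballI; (elim conjE)?)
  assume iso: "is_nat_iso A B F G \<alpha>"
  then show nt: "is_nat_trans A B F G \<alpha>" by (simp add: is_nat_iso_def)
  fix x assume x: "x \<in> Obj A"
  obtain \<beta> where \<beta>: "is_nat_trans A B G F \<beta>"
    and *: "vcomp A B \<beta> \<alpha> = id_nat A B F" "vcomp A B \<alpha> \<beta> = id_nat A B G"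
    using iso by (auto simp: is_nat_iso_def)
  interpret B: category B using functor_cat nt unfolding is_nat_trans_def by blast
  note p = nat_trans_props[OF nt] nat_trans_props[OF \<beta>]
  show "is_iso_arr B (\<alpha> x)"
    by (rule B.is_iso_arrI[where g = "\<beta> x"])
      (use x p fun_cong[OF *(1), of x] fun_cong[OF *(2), of x] in
        \<open>auto simp: vcomp_def id_nat_def\<close>)
next
  assume nt: "is_nat_trans A B F G \<alpha>" and iso: "\<forall>x\<in>Obj A. is_iso_arr B (\<alpha> x)"
  interpret A: category A using functor_cat nt unfolding is_nat_trans_def by blast
  interpret B: category B using functor_cat nt unfolding is_nat_trans_def by blast
  note p = nat_trans_props[OF nt]
  define \<beta> where "\<beta> = (\<lambda>x\<in>Obj A. inv_arr B (\<alpha> x))"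
  have "is_nat_trans A B G F \<beta>"
  proof (rule nat_transI)
    fix f assume f: "f \<in> Arr A"
    have fF: "farr F f \<in> Arr B" "Dom B (farr F f) = fobj F (Dom A f)"
      "Cod B (farr F f) = fobj F (Cod A f)"
      and fG: "farr G f \<in> Arr B" "Dom B (farr G f) = fobj G (Dom A f)"
      "Cod B (farr G f) = fobj G (Cod A f)"
      using f p functor_arr functor_dom_cod by metis+
    show "Comp B (\<beta> (Cod A f)) (farr G f) = Comp B (farr F f) (\<beta> (Dom A f))"
    proof (rule B.iso_cancel_right[of "\<alpha> (Dom A f)"])
      have "Comp B (inv_arr B (\<alpha> (Cod A f))) (Comp B (farr G f) (\<alpha> (Dom A f))) = farr F f"
        using f iso p fF by (simp flip: p(4))
      then show "Comp B (Comp B (\<beta> (Cod A f)) (farr G f)) (\<alpha> (Dom A f)) =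
         Comp B (Comp B (farr F f) (\<beta> (Dom A f))) (\<alpha> (Dom A f))"
        using f iso p fF fG by (simp add: \<beta>_def)
    qed (use f iso p fF fG in \<open>auto simp: \<beta>_def\<close>)
  qed (use iso p in \<open>auto simp: \<beta>_def\<close>)
  moreover have "vcomp A B \<beta> \<alpha> = id_nat A B F" "vcomp A B \<alpha> \<beta> = id_nat A B G"
    using iso p by (auto simp: vcomp_def id_nat_def \<beta>_def fun_eq_iff)
  ultimately show "is_nat_iso A B F G \<alpha>" using nt by (auto simp: is_nat_iso_def)
qed

lemma functor_id: "is_category A \<Longrightarrow> is_functor A A (id_functor A)"
proof -
  assume A: "is_category A"
  then interpret A: category A by (simp add: category_def)
  show ?thesis by (rule is_functorI) (auto simp: id_functor_def A)
qed

lemma functor_comp_functor: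
  assumes "is_functor A B F" "is_functor B D G"
  shows "is_functor A D (comp_functor A G F)"
proof -
  interpret A: category A using functor_cat assms by blast
  interpret D: category D using functor_cat assms by blast
  note f = functor_obj[OF assms(1)] functor_obj[OF assms(2)]
    functor_arr[OF assms(1)] functor_arr[OF assms(2)]
    functor_dom_cod[OF assms(1)] functor_dom_cod[OF assms(2)]
    functor_comp[OF assms(1)] functor_comp[OF assms(2)]
    functor_ident[OF assms(1)] functor_ident[OF assms(2)]
  show ?thesis
    by (rule is_functorI) (auto simp: comp_functor_def f A.is_category D.is_category)
qed

text \<open>Choice supplies for each \<open>Y\<close> an object \<open>g Y\<close> with an
  isomorphism \<open>e Y\<close> from its image, and a lift \<open>L\<close> of each arrow between
  images. Faithfulness, in the form \<open>eqI\<close>, reduces every equation between arrows of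
  \<open>A\<close> to its image in \<open>B\<close>.\<close>

lemma equivalence_if_fully_faithful_ess_surj:
  assumes F: "is_functor A B F"
    and full: "\<And>X Y b. \<lbrakk>X \<in> Obj A; Y \<in> Obj A; b \<in> Hom B (fobj F X) (fobj F Y)\<rbrakk> \<Longrightarrow>
      \<exists>a\<in>Hom A X Y. farr F a = b"
    and faithful: "\<And>X Y a a'. \<lbrakk>X \<in> Obj A; Y \<in> Obj A; a \<in> Hom A X Y; a' \<in> Hom A X Y;
      farr F a = farr F a'\<rbrakk> \<Longrightarrow> a = a'"
    and ess: "\<And>Y. Y \<in> Obj B \<Longrightarrow>
      \<exists>X\<in>Obj A. \<exists>e. is_iso_arr B e \<and> Dom B e = fobj F X \<and> Cod B e = Y"
  shows "is_equivalence A B F"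
proof -
  interpret A: category A using functor_cat F by blast
  interpret B: category B using functor_cat F by blast
  note fF = functor_obj[OF F] functor_arr[OF F] functor_dom_cod[OF F] functor_comp[OF F]
    functor_ident[OF F]
  obtain g e where g: "\<And>Y. Y \<in> Obj B \<Longrightarrow> g Y \<in> Obj A"
    and e: "\<And>Y. Y \<in> Obj B \<Longrightarrow> is_iso_arr B (e Y)" "\<And>Y. Y \<in> Obj B \<Longrightarrow> Dom B (e Y) = fobj F (g Y)"
      "\<And>Y. Y \<in> Obj B \<Longrightarrow> Cod B (e Y) = Y"
    using ess by metis
  have "\<exists>a. a \<in> Hom A X Y \<and> farr F a = b"
    if "X \<in> Obj A" "Y \<in> Obj A" "b \<in> Arr B" "Dom B b = fobj F X" "Cod B b = fobj F Y" for X Y b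
    using full[of X Y b] that by (auto simp: Hom_def)
  then obtain L where L: "\<And>X Y b. \<lbrakk>X \<in> Obj A; Y \<in> Obj A; b \<in> Arr B; Dom B b = fobj F X;
      Cod B b = fobj F Y\<rbrakk> \<Longrightarrow> L X Y b \<in> Hom A X Y \<and> farr F (L X Y b) = b"
    by metis
  have Lp: "L X Y b \<in> Arr A" "Dom A (L X Y b) = X" "Cod A (L X Y b) = Y" "farr F (L X Y b) = b"
    if "X \<in> Obj A" "Y \<in> Obj A" "b \<in> Arr B" "Dom B b = fobj F X" "Cod B b = fobj F Y" for X Y b
    using L[OF that] by (auto simp: Hom_def)
  have eqI: "a = a'" if "a \<in> Arr A" "a' \<in> Arr A" "Dom A a = Dom A a'" "Cod A a = Cod A a'"
      "farr F a = farr F a'" for a a'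
    by (rule faithful[of "Dom A a" "Cod A a"]) (use that in \<open>auto simp: Hom_def\<close>)
  \<comment> \<open>An arrow \<open>b\<close> is conjugated by \<open>e\<close> so that it runs
    between images, and then lifted; \<open>e\<close> becomes the counit.\<close>
  define G where "G = \<lparr>fobj = (\<lambda>Y\<in>Obj B. g Y), farr = (\<lambda>b\<in>Arr B. L (g (Dom B b)) (g (Cod B b))
      (Comp B (inv_arr B (e (Cod B b))) (Comp B b (e (Dom B b)))))\<rparr>"
  have Gf: "is_functor B A G"
    by (rule is_functorI)
      (auto simp: G_def A.is_category B.is_category g Lp e fF intro!: eqI)
  have "is_nat_iso B B (comp_functor B F G) (id_functor B) (\<lambda>Y\<in>Obj B. e Y)"
    unfolding is_nat_iso_iff
    by (intro conjI nat_transI functor_id functor_comp_functor[OF Gf F])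
      (auto simp: G_def comp_functor_def id_functor_def B.is_category g Lp e fF)
  moreover
  \<comment> \<open>The unit at \<open>X\<close> lifts the inverse of the counit at the image of
    \<open>X\<close>; lifting the counit itself gives its inverse.\<close>
  have isoL: "is_iso_arr A (L X (g (fobj F X)) (inv_arr B (e (fobj F X))))" if "X \<in> Obj A" for X
    by (rule A.is_iso_arrI[where g = "L (g (fobj F X)) X (e (fobj F X))"])
      (use that in \<open>auto simp: g Lp e fF intro!: eqI\<close>)
  have "is_nat_iso A A (id_functor A) (comp_functor A G F)
     (\<lambda>X\<in>Obj A. L X (g (fobj F X)) (inv_arr B (e (fobj F X))))"
    unfolding is_nat_iso_iff
    by (intro conjI nat_transI functor_id functor_comp_functor[OF F Gf])
      (auto simp: G_def comp_functor_def id_functor_def A.is_category g Lp e fF isoL intro!: eqI)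
  ultimately show ?thesis
    using F Gf unfolding is_equivalence_def by blast
qed

text \<open>Conjugation by isomorphisms identifies the hom-sets of \<open>A\<close> with those
  between representatives, and functors preserve isomorphisms. The representatives will be the
  normalised actions, between which morphisms can be glued.\<close>

lemma equivalence_criterion:
  assumes F: "is_functor A B F"
    and rep: "\<And>X. X \<in> Obj A \<Longrightarrow>
      \<exists>X0\<in>reps. \<exists>i. is_iso_arr A i \<and> Dom A i = X0 \<and> Cod A i = X"
    and full: "\<And>X Y b. \<lbrakk>X \<in> reps; Y \<in> reps; b \<in> Hom B (fobj F X) (fobj F Y)\<rbrakk> \<Longrightarrow>
      \<exists>a\<in>Hom A X Y. farr F a = b"
    and faithful: "\<And>X Y a a'. \<lbrakk>X \<in> reps; Y \<in> reps; a \<in> Hom A X Y; a' \<in> Hom A X Y;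
      farr F a = farr F a'\<rbrakk> \<Longrightarrow> a = a'"
    and ess: "\<And>Y. Y \<in> Obj B \<Longrightarrow>
      \<exists>X\<in>Obj A. \<exists>e. is_iso_arr B e \<and> Dom B e = fobj F X \<and> Cod B e = Y"
  shows "is_equivalence A B F"
proof (rule equivalence_if_fully_faithful_ess_surj[OF F])
  interpret A: category A using functor_cat F by blast
  interpret B: category B using functor_cat F by blast
  note fF = functor_obj[OF F] functor_arr[OF F] functor_dom_cod[OF F] functor_comp[OF F]
    functor_ident[OF F] functor_iso[OF F]
  fix X Y assume X: "X \<in> Obj A" and Y: "Y \<in> Obj A"
  obtain X0 i where i: "X0 \<in> reps" "is_iso_arr A i" "Dom A i = X0" "Cod A i = X"
    using rep[OF X] by blast
  obtain Y0 j where j: "Y0 \<in> reps" "is_iso_arr A j" "Dom A j = Y0" "Cod A j = Y"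
    using rep[OF Y] by blast
  {
    fix b assume "b \<in> Hom B (fobj F X) (fobj F Y)"
    then have b: "b \<in> Arr B" "Dom B b = fobj F X" "Cod B b = fobj F Y" by (auto simp: Hom_def)
    obtain a where "a \<in> Hom A X0 Y0"
      and a': "farr F a = Comp B (inv_arr B (farr F j)) (Comp B b (farr F i))"
      using full[of X0 Y0 "Comp B (inv_arr B (farr F j)) (Comp B b (farr F i))"] i j b
      by (auto simp: Hom_def fF simp del: fF(8))
    then have a: "a \<in> Arr A" "Dom A a = X0" "Cod A a = Y0" by (auto simp: Hom_def)
    have "farr F (Comp A j (Comp A a (inv_arr A i))) =
      Comp B (farr F j) (Comp B (farr F a) (inv_arr B (farr F i)))"
      using a i j by (simp add: fF)
    \<comment> \<open>The rule \<open>fF(8)\<close> would rewrite inverses of images as images of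
      inverses; with it switched off the inverses cancel in \<open>B\<close>.\<close>
    also have "\<dots> = b" unfolding a' using b i j by (simp add: fF del: fF(8))
    finally show "\<exists>a\<in>Hom A X Y. farr F a = b"
      using a i j by (intro bexI[of _ "Comp A j (Comp A a (inv_arr A i))"]) (auto simp: Hom_def)
  next
    fix a a' assume "a \<in> Hom A X Y" "a' \<in> Hom A X Y" and eq: "farr F a = farr F a'"
    then have a: "a \<in> Arr A" "Dom A a = X" "Cod A a = Y" "a' \<in> Arr A" "Dom A a' = X" "Cod A a' = Y"
      by (auto simp: Hom_def)
    have "Comp A (inv_arr A j) (Comp A a i) = Comp A (inv_arr A j) (Comp A a' i)"
      by (rule faithful[of X0 Y0]) (use i j a eq in \<open>auto simp: Hom_def fF\<close>)
    then have "Comp A a i = Comp A a' i"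
      by (rule A.iso_cancel_left[rotated -1]) (use i j a in auto)
    then show "a = a'"
      by (rule A.iso_cancel_right[rotated -1]) (use i j a in auto)
  }
qed (rule ess)

section \<open>Actions, componentwise\<close>

context category
begin

lemma fobj_obj [simp]: "is_functor C C F \<Longrightarrow> x \<in> Obj C \<Longrightarrow> fobj F x \<in> Obj C"
  and farr_arr [simp]: "is_functor C C F \<Longrightarrow> f \<in> Arr C \<Longrightarrow> farr F f \<in> Arr C"
  and dom_farr [simp]: "is_functor C C F \<Longrightarrow> f \<in> Arr C \<Longrightarrow> Dom C (farr F f) = fobj F (Dom C f)"
  and cod_farr [simp]: "is_functor C C F \<Longrightarrow> f \<in> Arr C \<Longrightarrow> Cod C (farr F f) = fobj F (Cod C f)"
  and farr_ident [simp]: "is_functor C C F \<Longrightarrow> x \<in> Obj C \<Longrightarrow> farr F (Ident C x) = Ident C (fobj F x)"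
  and farr_comp [simp]: "\<lbrakk>is_functor C C F; f \<in> Arr C; g \<in> Arr C; Dom C g = Cod C f\<rbrakk> \<Longrightarrow>
    farr F (g \<cdot> f) = farr F g \<cdot> farr F f"
  and farr_iso [simp]: "is_functor C C F \<Longrightarrow> is_iso_arr C f \<Longrightarrow> is_iso_arr C (farr F f)"
  by (simp_all add: functor_obj functor_arr functor_dom_cod functor_ident functor_comp functor_iso)

lemma fobj_comp_functor [simp]: "x \<in> Obj C \<Longrightarrow> fobj (comp_functor C F K) x = fobj F (fobj K x)"
  and farr_comp_functor [simp]: "f \<in> Arr C \<Longrightarrow> farr (comp_functor C F K) f = farr F (farr K f)"
  and fobj_id_functor [simp]: "x \<in> Obj C \<Longrightarrow> fobj (id_functor C) x = x"
  and farr_id_functor [simp]: "f \<in> Arr C \<Longrightarrow> farr (id_functor C) f = f"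
  by (simp_all add: comp_functor_def id_functor_def)

lemma functor_id_functor [simp]: "is_functor C C (id_functor C)"
  by (rule functor_id) (rule is_category)

lemma functor_comp_functor' [simp]:
  "is_functor C C F \<Longrightarrow> is_functor C C K \<Longrightarrow> is_functor C C (comp_functor C K F)"
  by (rule functor_comp_functor)

lemma comp_functor_id [simp]:
  assumes "is_functor C C F"
  shows "comp_functor C F (id_functor C) = F" "comp_functor C (id_functor C) F = F"
proof -
  have F: "fobj F \<in> extensional (Obj C)" "farr F \<in> extensional (Arr C)"
    using functor_ext[OF assms] by auto
  show "comp_functor C F (id_functor C) = F" "comp_functor C (id_functor C) F = F"
    using F assms
    by (auto intro!: cfunctor.equality intro: extensionalityI[OF _ F(1)] extensionalityI[OF _ F(2)]
        simp: comp_functor_def id_functor_def)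
qed

text \<open>In right-nested composites the side of a square mostly occurs in front of further
  arrows. \<open>comp_extend[OF eq]\<close> makes \<open>eq\<close> a rewrite rule for that
  position; the diagram chases below are sequences of such rewrites.\<close>

lemma comp_extend:
  assumes "p \<cdot> q = r" "p \<in> Arr C" "q \<in> Arr C" "z \<in> Arr C" "Dom C p = Cod C q" "Dom C q = Cod C z"
  shows "p \<cdot> q \<cdot> z = r \<cdot> z"
  using assms comp_assoc[of z q p] by simp

lemma id_nat_iso: "is_functor C C F \<Longrightarrow> is_nat_iso C C F F (id_nat C C F)"
  unfolding is_nat_iso_iff by (auto intro!: nat_transI simp: id_nat_def)

lemma nat_trans_eqI:
  assumes "is_nat_trans C C F K \<alpha>" "is_nat_trans C C F' K' \<beta>" "\<And>x. x \<in> Obj C \<Longrightarrow> \<alpha> x = \<beta> x"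
  shows "\<alpha> = \<beta>"
  using assms(3) nat_trans_ext[OF assms(1)] nat_trans_ext[OF assms(2)]
  by (rule extensionalityI[rotated 2])

end

locale cat_monoid = category C + monoid G
  for C :: "('o, 'm) cat" and G :: "('g, 'x) monoid_scheme" (structure)
begin

text \<open>Horizontal composition with an identity either evaluates a component at
  \<open>fobj (act T h) x\<close> or applies \<open>act T f\<close> to it; this gives coherence its
  componentwise form.\<close>

lemma is_actionI:
  assumes "act T \<in> extensional (carrier G)" "mulc T \<in> extensional (carrier G \<times> carrier G)"
    and [simp]: "\<And>g. g \<in> carrier G \<Longrightarrow> is_functor C C (act T g)"
    and c: "\<And>f g. f \<in> carrier G \<Longrightarrow> g \<in> carrier G \<Longrightarrow>
      is_nat_iso C C (comp_functor C (act T f) (act T g)) (act T (f \<otimes> g)) (mulc T (f, g))"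
    and "is_nat_iso C C (act T \<one>) (id_functor C) (unitc T)"
    and assoc: "\<And>f g h x. \<lbrakk>f \<in> carrier G; g \<in> carrier G; h \<in> carrier G; x \<in> Obj C\<rbrakk> \<Longrightarrow>
      mulc T (f \<otimes> g, h) x \<cdot> mulc T (f, g) (fobj (act T h) x) =
      mulc T (f, g \<otimes> h) x \<cdot> farr (act T f) (mulc T (g, h) x)"
  shows "is_action C G T"
proof -
  have c': "is_nat_trans C C (comp_functor C (act T f) (act T g)) (act T (f \<otimes> g)) (mulc T (f, g))"
    if "f \<in> carrier G" "g \<in> carrier G" for f g
    using c[OF that] by (simp add: is_nat_iso_def)
  note p = nat_trans_arr[OF c'] nat_trans_dom[OF c'] nat_trans_cod[OF c']
  have "vcomp C C (mulc T (f \<otimes> g, h))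
         (hcomp C C (comp_functor C (act T f) (act T g)) (act T h)
            (mulc T (f, g)) (id_nat C C (act T h))) =
       vcomp C C (mulc T (f, g \<otimes> h))
         (hcomp C C (act T f) (act T (g \<otimes> h)) (id_nat C C (act T f)) (mulc T (g, h)))"
    if "f \<in> carrier G" "g \<in> carrier G" "h \<in> carrier G" for f g h
    unfolding vcomp_def hcomp_def id_nat_def
    by (rule restrict_ext) (use that in \<open>auto simp: p assoc\<close>)
  then show ?thesis
    using assms unfolding is_action_def by blast
qed

lemma
  assumes "is_action C G T"
  shows act_ext: "act T \<in> extensional (carrier G)"
    and act_functor [simp]: "g \<in> carrier G \<Longrightarrow> is_functor C C (act T g)"
    and mulc_nat_iso: "f \<in> carrier G \<Longrightarrow> g \<in> carrier G \<Longrightarrow>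
      is_nat_iso C C (comp_functor C (act T f) (act T g)) (act T (f \<otimes> g)) (mulc T (f, g))"
    and unitc_nat_iso: "is_nat_iso C C (act T \<one>) (id_functor C) (unitc T)"
  using assms unfolding is_action_def by blast+

lemma mulc_nat_trans:
  assumes "is_action C G T" "f \<in> carrier G" "g \<in> carrier G"
  shows "is_nat_trans C C (comp_functor C (act T f) (act T g)) (act T (f \<otimes> g)) (mulc T (f, g))"
  using mulc_nat_iso[OF assms] by (simp add: is_nat_iso_def)

lemma
  assumes "is_action C G T" "f \<in> carrier G" "g \<in> carrier G" "x \<in> Obj C"
  shows mulc_iso [simp]: "is_iso_arr C (mulc T (f, g) x)"
    and mulc_arr [simp]: "mulc T (f, g) x \<in> Arr C"
    and dom_mulc [simp]: "Dom C (mulc T (f, g) x) = fobj (act T f) (fobj (act T g) x)"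
    and cod_mulc [simp]: "Cod C (mulc T (f, g) x) = fobj (act T (f \<otimes> g)) x"
  using nat_trans_arr[OF mulc_nat_trans[OF assms(1-3)]] nat_trans_dom[OF mulc_nat_trans[OF assms(1-3)]]
    nat_trans_cod[OF mulc_nat_trans[OF assms(1-3)]] mulc_nat_iso[OF assms(1-3)] assms
  by (auto simp: is_nat_iso_iff)

lemma mulc_natural:
  assumes "is_action C G T" "f \<in> carrier G" "g \<in> carrier G" "a \<in> Arr C" "Dom C a = x" "Cod C a = y"
  shows "mulc T (f, g) y \<cdot> farr (act T f) (farr (act T g) a) =
    farr (act T (f \<otimes> g)) a \<cdot> mulc T (f, g) x"
  using nat_trans_natural[OF mulc_nat_trans[OF assms(1-3)] assms(4)] assms by simp

lemma mulc_assoc: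
  assumes "is_action C G T" "f \<in> carrier G" "g \<in> carrier G" "h \<in> carrier G" "x \<in> Obj C"
  shows "mulc T (f \<otimes> g, h) x \<cdot> mulc T (f, g) (fobj (act T h) x) =
      mulc T (f, g \<otimes> h) x \<cdot> farr (act T f) (mulc T (g, h) x)"
proof -
  have "vcomp C C (mulc T (f \<otimes> g, h))
         (hcomp C C (comp_functor C (act T f) (act T g)) (act T h)
            (mulc T (f, g)) (id_nat C C (act T h))) x =
       vcomp C C (mulc T (f, g \<otimes> h))
         (hcomp C C (act T f) (act T (g \<otimes> h)) (id_nat C C (act T f)) (mulc T (g, h))) x"
    using assms by (simp add: is_action_def)
  then show ?thesis using assms by (simp add: vcomp_def hcomp_def id_nat_def)
qed

text \<open>The source is a bare family \<open>S\<close> with maps \<open>c\<close>, not an action,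
  so that the condition is available while \<open>c\<close> is still to be proved coherent. Stating
  it at a single pair allows it to be propagated from pair to pair.\<close>

definition compatible ::
    "('g \<Rightarrow> ('o, 'm, 'o, 'm) cfunctor) \<Rightarrow> ('g \<times> 'g \<Rightarrow> 'o \<Rightarrow> 'm) \<Rightarrow> ('g, 'o, 'm) action \<Rightarrow>
      ('g \<Rightarrow> 'o \<Rightarrow> 'm) \<Rightarrow> 'g \<Rightarrow> 'g \<Rightarrow> bool"
  where "compatible S c T \<phi> f g \<longleftrightarrow> (\<forall>x\<in>Obj C.
    \<phi> (f \<otimes> g) x \<cdot> c (f, g) x =
    mulc T (f, g) x \<cdot> \<phi> f (fobj (act T g) x) \<cdot> farr (S f) (\<phi> g x))"

lemma is_action_mor_iff:
  "is_action_mor C G m \<longleftrightarrow>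
    is_action C G (msrc m) \<and> is_action C G (mtgt m) \<and> mfam m \<in> extensional (carrier G) \<and>
    (\<forall>f\<in>carrier G. is_nat_trans C C (act (msrc m) f) (act (mtgt m) f) (mfam m f)) \<and>
    (\<forall>f\<in>carrier G. \<forall>g\<in>carrier G.
      compatible (act (msrc m)) (mulc (msrc m)) (mtgt m) (mfam m) f g) \<and>
    (\<forall>x\<in>Obj C. is_iso_arr C (mfam m \<one> x))"
proof -
  have "vcomp C C (mfam m (f \<otimes> g)) (mulc (msrc m) (f, g)) =
       vcomp C C (mulc (mtgt m) (f, g))
         (hcomp C C (act (msrc m) f) (act (mtgt m) g) (mfam m f) (mfam m g)) \<longleftrightarrow>
     compatible (act (msrc m)) (mulc (msrc m)) (mtgt m) (mfam m) f g" for f g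
    by (auto simp: compatible_def vcomp_def hcomp_def fun_eq_iff restrict_def)
  then show ?thesis unfolding is_action_mor_def is_nat_iso_iff by auto
qed

lemma
  assumes "is_action_mor C G m"
  shows msrc_action [simp]: "is_action C G (msrc m)"
    and mtgt_action [simp]: "is_action C G (mtgt m)"
    and mfam_ext: "mfam m \<in> extensional (carrier G)"
    and mfam_nat: "f \<in> carrier G \<Longrightarrow> is_nat_trans C C (act (msrc m) f) (act (mtgt m) f) (mfam m f)"
    and mfam_compatible: "f \<in> carrier G \<Longrightarrow> g \<in> carrier G \<Longrightarrow>
      compatible (act (msrc m)) (mulc (msrc m)) (mtgt m) (mfam m) f g"
    and mfam_one_iso: "x \<in> Obj C \<Longrightarrow> is_iso_arr C (mfam m \<one> x)"
  using assms unfolding is_action_mor_iff by blast+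

lemma
  assumes "is_action_mor C G m" "f \<in> carrier G"
  shows mfam_arr [simp]: "x \<in> Obj C \<Longrightarrow> mfam m f x \<in> Arr C"
    and dom_mfam [simp]: "x \<in> Obj C \<Longrightarrow> Dom C (mfam m f x) = fobj (act (msrc m) f) x"
    and cod_mfam [simp]: "x \<in> Obj C \<Longrightarrow> Cod C (mfam m f x) = fobj (act (mtgt m) f) x"
    and mfam_natural: "a \<in> Arr C \<Longrightarrow> Dom C a = x \<Longrightarrow> Cod C a = y \<Longrightarrow>
      mfam m f y \<cdot> farr (act (msrc m) f) a = farr (act (mtgt m) f) a \<cdot> mfam m f x"
  using nat_trans_props[OF mfam_nat[OF assms]] by auto

lemma mfam_mult:
  assumes "is_action_mor C G m" "f \<in> carrier G" "g \<in> carrier G" "x \<in> Obj C"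
  shows "mfam m (f \<otimes> g) x \<cdot> mulc (msrc m) (f, g) x =
    mulc (mtgt m) (f, g) x \<cdot> mfam m f (fobj (act (mtgt m) g) x) \<cdot>
      farr (act (msrc m) f) (mfam m g x)"
  using mfam_compatible[OF assms(1-3)] assms(4) by (simp add: compatible_def)

text \<open>Both sides express the composite \<open>S f \<circ> S g \<circ> S h \<rightarrow> T (f \<otimes> g \<otimes> h)\<close> in which \<open>f, g\<close>,
  respectively \<open>g, h\<close>, are multiplied in \<open>S\<close> and the third factor in \<open>T\<close>.\<close>

lemma compatible_triple:
  assumes T: "is_action C G T"
    and S: "\<And>g. g \<in> carrier G \<Longrightarrow> is_functor C C (S g)"
    and c: "\<And>f g. f \<in> carrier G \<Longrightarrow> g \<in> carrier G \<Longrightarrow>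
      is_nat_trans C C (comp_functor C (S f) (S g)) (S (f \<otimes> g)) (c (f, g))"
    and \<phi>: "\<And>g. g \<in> carrier G \<Longrightarrow> is_nat_trans C C (S g) (act T g) (\<phi> g)"
    and fgh [simp]: "f \<in> carrier G" "g \<in> carrier G" "h \<in> carrier G" and x [simp]: "x \<in> Obj C"
    and fg: "compatible S c T \<phi> f g" and gh: "compatible S c T \<phi> g h"
  shows "mulc T (f \<otimes> g, h) x \<cdot> \<phi> (f \<otimes> g) (fobj (act T h) x) \<cdot> farr (S (f \<otimes> g)) (\<phi> h x) \<cdot>
      c (f, g) (fobj (S h) x) =
    mulc T (f, g \<otimes> h) x \<cdot> \<phi> f (fobj (act T (g \<otimes> h)) x) \<cdot>
      farr (S f) (\<phi> (g \<otimes> h) x) \<cdot> farr (S f) (c (g, h) x)"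
proof -
  note [simp] = T S
  note c' [simp] = nat_trans_arr[OF c] nat_trans_dom[OF c] nat_trans_cod[OF c]
  note \<phi>' [simp] = nat_trans_arr[OF \<phi>] nat_trans_dom[OF \<phi>] nat_trans_cod[OF \<phi>]
  \<comment> \<open>Coherence is taken from \<open>T\<close> alone: move \<open>\<phi> h\<close>
    past \<open>c\<close>, use compatibility at \<open>(f, g)\<close>, coherence of
    \<open>T\<close>, naturality of \<open>\<phi> f\<close>, and compatibility at
    \<open>(g, h)\<close> under \<open>S f\<close>.\<close>
  have 1: "farr (S (f \<otimes> g)) (\<phi> h x) \<cdot> c (f, g) (fobj (S h) x) =
    c (f, g) (fobj (act T h) x) \<cdot> farr (S f) (farr (S g) (\<phi> h x))"
    using nat_trans_natural[OF c, of f g "\<phi> h x"] by simp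
  have 2: "\<phi> (f \<otimes> g) (fobj (act T h) x) \<cdot> c (f, g) (fobj (act T h) x) =
    mulc T (f, g) (fobj (act T h) x) \<cdot> \<phi> f (fobj (act T g) (fobj (act T h) x)) \<cdot>
      farr (S f) (\<phi> g (fobj (act T h) x))"
    using fg by (simp add: compatible_def)
  have 3: "mulc T (f \<otimes> g, h) x \<cdot> mulc T (f, g) (fobj (act T h) x) =
    mulc T (f, g \<otimes> h) x \<cdot> farr (act T f) (mulc T (g, h) x)"
    by (rule mulc_assoc) auto
  have 4: "farr (act T f) (mulc T (g, h) x) \<cdot> \<phi> f (fobj (act T g) (fobj (act T h) x)) =
    \<phi> f (fobj (act T (g \<otimes> h)) x) \<cdot> farr (S f) (mulc T (g, h) x)"
    using nat_trans_natural[OF \<phi>, of f "mulc T (g, h) x"] by simp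
  have 5: "\<phi> (g \<otimes> h) x \<cdot> c (g, h) x =
    mulc T (g, h) x \<cdot> \<phi> g (fobj (act T h) x) \<cdot> farr (S g) (\<phi> h x)"
    using gh by (simp add: compatible_def)
  have 6: "farr (S f) (\<phi> (g \<otimes> h) x) \<cdot> farr (S f) (c (g, h) x) = farr (S f)
    (mulc T (g, h) x \<cdot> \<phi> g (fobj (act T h) x) \<cdot> farr (S g) (\<phi> h x))"
    by (simp flip: 5)
  show ?thesis
    by (simp add: 1 comp_extend[OF 2] comp_extend[OF 3] comp_extend[OF 4] 6)
qed

text \<open>Precompose the equations with \<open>mulc S (f, g)\<close> and with the image of
  \<open>mulc S (g, h)\<close> under \<open>act S f\<close>, respectively. Their left sides then
  agree by coherence of \<open>S\<close>, their right sides by \<open>compatible_triple\<close>, and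
  the isomorphisms cancel. Gluing morphisms uses both directions.\<close>

lemma compatible_mult:
  assumes S: "is_action C G S" and T: "is_action C G T"
    and \<phi>: "\<And>g. g \<in> carrier G \<Longrightarrow> is_nat_trans C C (act S g) (act T g) (\<phi> g)"
    and fgh [simp]: "f \<in> carrier G" "g \<in> carrier G" "h \<in> carrier G"
    and comp: "compatible (act S) (mulc S) T \<phi> f g" "compatible (act S) (mulc S) T \<phi> g h"
  shows "compatible (act S) (mulc S) T \<phi> (f \<otimes> g) h \<longleftrightarrow>
    compatible (act S) (mulc S) T \<phi> f (g \<otimes> h)"
proof -
  note [simp] = T S
  note \<phi>' [simp] = nat_trans_arr[OF \<phi>] nat_trans_dom[OF \<phi>] nat_trans_cod[OF \<phi>]
  have "\<phi> (f \<otimes> g \<otimes> h) x \<cdot> mulc S (f \<otimes> g, h) x =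
      mulc T (f \<otimes> g, h) x \<cdot> \<phi> (f \<otimes> g) (fobj (act T h) x) \<cdot> farr (act S (f \<otimes> g)) (\<phi> h x) \<longleftrightarrow>
    \<phi> (f \<otimes> (g \<otimes> h)) x \<cdot> mulc S (f, g \<otimes> h) x =
      mulc T (f, g \<otimes> h) x \<cdot> \<phi> f (fobj (act T (g \<otimes> h)) x) \<cdot> farr (act S f) (\<phi> (g \<otimes> h) x)"
    (is "?a = ?b \<longleftrightarrow> ?c = ?d")
    if x [simp]: "x \<in> Obj C" for x
  proof -
    have "?a = ?b \<longleftrightarrow>
      ?a \<cdot> mulc S (f, g) (fobj (act S h) x) = ?b \<cdot> mulc S (f, g) (fobj (act S h) x)"
      by (rule iffI, simp, rule iso_cancel_right[of "mulc S (f, g) (fobj (act S h) x)"])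
        (auto simp: m_assoc)
    moreover have "?c = ?d \<longleftrightarrow>
      ?c \<cdot> farr (act S f) (mulc S (g, h) x) = ?d \<cdot> farr (act S f) (mulc S (g, h) x)"
      by (rule iffI, simp, rule iso_cancel_right[of "farr (act S f) (mulc S (g, h) x)"])
        (auto simp: m_assoc)
    moreover have "?a \<cdot> mulc S (f, g) (fobj (act S h) x) = ?c \<cdot> farr (act S f) (mulc S (g, h) x)"
      using mulc_assoc[OF S fgh x] by (simp add: m_assoc)
    moreover have "?b \<cdot> mulc S (f, g) (fobj (act S h) x) = ?d \<cdot> farr (act S f) (mulc S (g, h) x)"
      using compatible_triple[OF T _ _ _ fgh x comp] mulc_nat_trans[OF S] \<phi>
      by (simp add: m_assoc)
    ultimately show ?thesis by simp
  qed
  then show ?thesis by (simp add: compatible_def)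
qed

section \<open>The category of actions and its isomorphisms\<close>

lemma is_action_mor_ident:
  assumes "is_action C G T"
  shows "is_action_mor C G \<lparr>msrc = T, mtgt = T, mfam = (\<lambda>f\<in>carrier G. id_nat C C (act T f))\<rparr>"
  unfolding is_action_mor_iff
  using assms by (auto simp: compatible_def intro!: nat_transI simp: id_nat_def)

lemma is_action_mor_comp:
  assumes m: "is_action_mor C G m" and n: "is_action_mor C G n" and [simp]: "msrc n = mtgt m"
  shows "is_action_mor C G \<lparr>msrc = msrc m, mtgt = mtgt n,
    mfam = (\<lambda>f\<in>carrier G. vcomp C C (mfam n f) (mfam m f))\<rparr>"
proof -
  note [simp] = m n
  have tgt [simp]: "is_action C G (mtgt m)" using mtgt_action[OF m] .
  note n' [simp] = dom_mfam[OF n, unfolded assms(3)]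
  have 1: "compatible (act (msrc m)) (mulc (msrc m)) (mtgt n)
    (\<lambda>f\<in>carrier G. vcomp C C (mfam n f) (mfam m f)) f g"
    if [simp]: "f \<in> carrier G" "g \<in> carrier G" for f g
    unfolding compatible_def
  proof
    fix x assume [simp]: "x \<in> Obj C"
    have 1: "mfam n (f \<otimes> g) x \<cdot> mulc (mtgt m) (f, g) x = mulc (mtgt n) (f, g) x \<cdot>
        mfam n f (fobj (act (mtgt n) g) x) \<cdot> farr (act (mtgt m) f) (mfam n g x)"
      using mfam_mult[OF n, of f g x] by simp
    have 2: "farr (act (mtgt m) f) (mfam n g x) \<cdot> mfam m f (fobj (act (mtgt m) g) x) =
      mfam m f (fobj (act (mtgt n) g) x) \<cdot> farr (act (msrc m) f) (mfam n g x)"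
      using mfam_natural[OF m, of f "mfam n g x"] by simp
    show "(\<lambda>f\<in>carrier G. vcomp C C (mfam n f) (mfam m f)) (f \<otimes> g) x \<cdot> mulc (msrc m) (f, g) x =
      mulc (mtgt n) (f, g) x \<cdot>
      (\<lambda>f\<in>carrier G. vcomp C C (mfam n f) (mfam m f)) f (fobj (act (mtgt n) g) x) \<cdot>
      farr (act (msrc m) f) ((\<lambda>f\<in>carrier G. vcomp C C (mfam n f) (mfam m f)) g x)"
      by (simp add: vcomp_def mfam_mult[OF m] comp_extend[OF 1] comp_extend[OF 2])
  qed
  have 2: "is_nat_trans C C (act (msrc m) f) (act (mtgt n) f) (vcomp C C (mfam n f) (mfam m f))"
    if [simp]: "f \<in> carrier G" for f
  proof (rule nat_transI)
    fix a assume [simp]: "a \<in> Arr C"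
    have 1: "mfam n f (Cod C a) \<cdot> farr (act (mtgt m) f) a =
      farr (act (mtgt n) f) a \<cdot> mfam n f (Dom C a)"
      using mfam_natural[OF n, of f a] by simp
    show "vcomp C C (mfam n f) (mfam m f) (Cod C a) \<cdot> farr (act (msrc m) f) a =
      farr (act (mtgt n) f) a \<cdot> vcomp C C (mfam n f) (mfam m f) (Dom C a)"
      by (simp add: vcomp_def mfam_natural[OF m, of f a] comp_extend[OF 1])
  qed (auto simp: vcomp_def)
  show ?thesis
    unfolding is_action_mor_iff using 1 2
    by (auto simp: vcomp_def mfam_one_iso)
qed

lemma action_mor_eqI:
  assumes "is_action_mor C G m" "is_action_mor C G n" "msrc m = msrc n" "mtgt m = mtgt n"
    "\<And>f x. f \<in> carrier G \<Longrightarrow> x \<in> Obj C \<Longrightarrow> mfam m f x = mfam n f x"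
  shows "m = n"
proof -
  have "mfam m f = mfam n f" if "f \<in> carrier G" for f
    by (rule nat_trans_eqI[OF mfam_nat[OF assms(1) that] mfam_nat[OF assms(2) that]])
      (use assms(5) that in auto)
  then have "mfam m = mfam n"
    by (rule extensionalityI[OF mfam_ext[OF assms(1)] mfam_ext[OF assms(2)]])
  then show ?thesis using assms(3,4) by (intro action_mor.equality) auto
qed

lemma action_cat_category: "is_category (action_cat C G)"
  unfolding is_category_def
proof (intro conjI ballI, goal_cases)
  case (4 S T U m n)
  then show ?case by (auto simp: action_cat_def Hom_def is_action_mor_comp)
next
  case (5 S T m)
  then have [simp]: "is_action_mor C G m" and *: "msrc m = S" "mtgt m = T"
    and [simp]: "is_action C G S" "is_action C G T"
    by (auto simp: action_cat_def Hom_def)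
  show ?case
    unfolding action_cat_def cat.simps
    by (intro conjI action_mor_eqI is_action_mor_comp is_action_mor_ident)
      (auto simp: * vcomp_def id_nat_def)
next
  case (6 S T m)
  then have [simp]: "is_action_mor C G m" and *: "msrc m = S" "mtgt m = T"
    and [simp]: "is_action C G S" "is_action C G T"
    by (auto simp: action_cat_def Hom_def)
  show ?case
    unfolding action_cat_def cat.simps
    by (intro conjI action_mor_eqI is_action_mor_comp is_action_mor_ident)
      (auto simp: * vcomp_def id_nat_def)
next
  case (7 S T U V m n p)
  then have [simp]: "is_action_mor C G m" "is_action_mor C G n" "is_action_mor C G p"
    and *: "msrc n = mtgt m" "msrc p = mtgt n"
    by (auto simp: action_cat_def Hom_def)
  show ?case
    unfolding action_cat_def cat.simps
    by (intro conjI action_mor_eqI is_action_mor_comp)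
      (auto simp: * vcomp_def)
qed (auto simp: action_cat_def Hom_def is_action_mor_ident)

text \<open>The inverse components are again compatible: after composition with
  \<open>mfam m (f \<otimes> g)\<close>, compatibility and naturality of \<open>m\<close> bring each
  inverse next to the arrow that it cancels.\<close>

lemma action_mor_iso:
  assumes m [simp]: "is_action_mor C G m"
    and iso [simp]: "\<And>f x. f \<in> carrier G \<Longrightarrow> x \<in> Obj C \<Longrightarrow> is_iso_arr C (mfam m f x)"
  shows "is_iso_arr (action_cat C G) m"
proof -
  interpret A: category "action_cat C G" by (simp add: category_def action_cat_category)
  define n where "n = \<lparr>msrc = mtgt m, mtgt = msrc m,
    mfam = (\<lambda>f\<in>carrier G. \<lambda>x\<in>Obj C. inv_arr C (mfam m f x))\<rparr>"
  have n_simps [simp]: "msrc n = mtgt m" "mtgt n = msrc m"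
    "\<And>f x. f \<in> carrier G \<Longrightarrow> x \<in> Obj C \<Longrightarrow> mfam n f x = inv_arr C (mfam m f x)"
    by (simp_all add: n_def)
  have nat: "is_nat_trans C C (act (mtgt m) f) (act (msrc m) f) (mfam n f)"
    if [simp]: "f \<in> carrier G" for f
  proof (rule nat_transI)
    fix a assume [simp]: "a \<in> Arr C"
    have 1: "mfam m f (Cod C a) \<cdot> farr (act (msrc m) f) a = farr (act (mtgt m) f) a \<cdot> mfam m f (Dom C a)"
      by (rule mfam_natural) auto
    show "mfam n f (Cod C a) \<cdot> farr (act (mtgt m) f) a = farr (act (msrc m) f) a \<cdot> mfam n f (Dom C a)"
      by (rule iso_cancel_left[of "mfam m f (Cod C a)"]) (auto simp: comp_extend[OF 1])
  qed (auto simp: n_def)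
  have comp: "compatible (act (mtgt m)) (mulc (mtgt m)) (msrc m) (mfam n) f g"
    if [simp]: "f \<in> carrier G" "g \<in> carrier G" for f g
    unfolding compatible_def
  proof
    fix x assume [simp]: "x \<in> Obj C"
    have 1: "mfam m (f \<otimes> g) x \<cdot> mulc (msrc m) (f, g) x =
      mulc (mtgt m) (f, g) x \<cdot> mfam m f (fobj (act (mtgt m) g) x) \<cdot>
        farr (act (msrc m) f) (mfam m g x)"
      by (rule mfam_mult) auto
    have 2: "mfam m f (fobj (act (mtgt m) g) x) \<cdot> farr (act (msrc m) f) (mfam m g x) =
      farr (act (mtgt m) f) (mfam m g x) \<cdot> mfam m f (fobj (act (msrc m) g) x)"
      by (rule mfam_natural) auto
    have 3: "farr (act (mtgt m) f) (mfam m g x) \<cdot> farr (act (mtgt m) f) (inv_arr C (mfam m g x)) =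
      Ident C (fobj (act (mtgt m) f) (fobj (act (mtgt m) g) x))"
      by (subst farr_comp[symmetric]) auto
    have 4: "mfam m f (fobj (act (msrc m) g) x) \<cdot> mfam n f (fobj (act (msrc m) g) x) =
      Ident C (fobj (act (mtgt m) f) (fobj (act (msrc m) g) x))"
      by simp
    show "mfam n (f \<otimes> g) x \<cdot> mulc (mtgt m) (f, g) x =
      mulc (msrc m) (f, g) x \<cdot> mfam n f (fobj (act (msrc m) g) x) \<cdot>
      farr (act (mtgt m) f) (mfam n g x)"
      by (rule iso_cancel_left[of "mfam m (f \<otimes> g) x"])
        (simp_all add: comp_extend[OF 1] comp_extend[OF 2] 3)
  qed
  have n [simp]: "is_action_mor C G n"
    unfolding is_action_mor_iff using nat comp by (auto simp: n_def)
  have "Comp (action_cat C G) n m = Ident (action_cat C G) (msrc m)"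
    "Comp (action_cat C G) m n = Ident (action_cat C G) (mtgt m)"
    unfolding action_cat_def cat.simps
    by (intro action_mor_eqI is_action_mor_comp is_action_mor_ident; simp add: vcomp_def id_nat_def)+
  then show ?thesis
    by (intro A.is_iso_arrI[where g = n]) (auto simp: action_cat_def)
qed

text \<open>Morphisms of actions do not refer to \<open>unitc\<close>, so the identities form an
  isomorphism even when \<open>unitc S\<close> and \<open>unitc T\<close> differ.\<close>

lemma action_iso_if_eq:
  assumes [simp]: "is_action C G S" "is_action C G T"
    and act: "\<And>g. g \<in> carrier G \<Longrightarrow> act S g = act T g"
    and mulc: "\<And>f g x. \<lbrakk>f \<in> carrier G; g \<in> carrier G; x \<in> Obj C\<rbrakk> \<Longrightarrow> mulc S (f, g) x = mulc T (f, g) x"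
  obtains m where "is_iso_arr (action_cat C G) m" "Dom (action_cat C G) m = S"
    "Cod (action_cat C G) m = T"
proof -
  define m where "m = \<lparr>msrc = S, mtgt = T, mfam = (\<lambda>f\<in>carrier G. id_nat C C (act T f))\<rparr>"
  have "is_action_mor C G m"
    unfolding is_action_mor_iff m_def
    by (auto simp: compatible_def act mulc id_nat_def intro!: nat_transI)
  then have "is_iso_arr (action_cat C G) m"
    by (rule action_mor_iso) (simp add: m_def id_nat_def)
  then show ?thesis using that[of m] by (simp add: m_def action_cat_def)
qed

section \<open>Normalised actions\<close>

text \<open>Transport of structure: the formula for \<open>mulc T'\<close> is the only one that
  makes \<open>\<phi>\<close> compatible. It is part of the conclusion because normalisation
  computes with it.\<close>

lemma transport_action:
  assumes T [simp]: "is_action C G T" and S: "S \<in> extensional (carrier G)"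
    and \<phi>: "\<And>g. g \<in> carrier G \<Longrightarrow> is_nat_iso C C (S g) (act T g) (\<phi> g)"
  obtains T' m where "is_action C G T'" "act T' = S"
    "\<And>f g x. \<lbrakk>f \<in> carrier G; g \<in> carrier G; x \<in> Obj C\<rbrakk> \<Longrightarrow> mulc T' (f, g) x =
      inv_arr C (\<phi> (f \<otimes> g) x) \<cdot> mulc T (f, g) x \<cdot> \<phi> f (fobj (act T g) x) \<cdot> farr (S f) (\<phi> g x)"
    "is_iso_arr (action_cat C G) m" "Dom (action_cat C G) m = T'" "Cod (action_cat C G) m = T"
proof -
  have \<phi>t: "is_nat_trans C C (S g) (act T g) (\<phi> g)" if "g \<in> carrier G" for g
    using \<phi>[OF that] by (simp add: is_nat_iso_def)
  have [simp]: "is_iso_arr C (\<phi> g x)" if "g \<in> carrier G" "x \<in> Obj C" for g x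
    using \<phi>[OF that(1)] that(2) by (simp add: is_nat_iso_iff)
  note [simp] = nat_trans_arr[OF \<phi>t] nat_trans_dom[OF \<phi>t] nat_trans_cod[OF \<phi>t]
    nat_trans_functors(1)[OF \<phi>t]
  define c where "c = (\<lambda>(f, g)\<in>carrier G \<times> carrier G. \<lambda>x\<in>Obj C.
    inv_arr C (\<phi> (f \<otimes> g) x) \<cdot> mulc T (f, g) x \<cdot> \<phi> f (fobj (act T g) x) \<cdot> farr (S f) (\<phi> g x))"
  have c: "c (f, g) x = inv_arr C (\<phi> (f \<otimes> g) x) \<cdot> mulc T (f, g) x \<cdot> \<phi> f (fobj (act T g) x) \<cdot>
      farr (S f) (\<phi> g x)"
    if "f \<in> carrier G" "g \<in> carrier G" "x \<in> Obj C" for f g x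
    using that by (simp add: c_def)
  define T' where "T' = \<lparr>act = S, mulc = c, unitc = vcomp C C (unitc T) (\<phi> \<one>)\<rparr>"
  have T': "act T' = S" "mulc T' = c" by (simp_all add: T'_def)
  have comp: "compatible S c T \<phi> f g" if [simp]: "f \<in> carrier G" "g \<in> carrier G" for f g
    by (simp add: compatible_def c)
  have c_iso: "is_nat_iso C C (comp_functor C (S f) (S g)) (S (f \<otimes> g)) (c (f, g))"
    if [simp]: "f \<in> carrier G" "g \<in> carrier G" for f g
    unfolding is_nat_iso_iff
  proof (intro conjI ballI nat_transI)
    fix a assume [simp]: "a \<in> Arr C"
    let ?x = "Dom C a" and ?y = "Cod C a"
    have 1: "farr (S f) (\<phi> g ?y) \<cdot> farr (S f) (farr (S g) a) =
      farr (S f) (farr (act T g) a) \<cdot> farr (S f) (\<phi> g ?x)"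
      using nat_trans_natural[OF \<phi>t, of g a] by (simp flip: farr_comp)
    have 2: "\<phi> f (fobj (act T g) ?y) \<cdot> farr (S f) (farr (act T g) a) =
      farr (act T f) (farr (act T g) a) \<cdot> \<phi> f (fobj (act T g) ?x)"
      using nat_trans_natural[OF \<phi>t, of f "farr (act T g) a"] by simp
    have 3: "mulc T (f, g) ?y \<cdot> farr (act T f) (farr (act T g) a) =
      farr (act T (f \<otimes> g)) a \<cdot> mulc T (f, g) ?x"
      by (rule mulc_natural) auto
    have 4: "\<phi> (f \<otimes> g) ?y \<cdot> farr (S (f \<otimes> g)) a = farr (act T (f \<otimes> g)) a \<cdot> \<phi> (f \<otimes> g) ?x"
      using nat_trans_natural[OF \<phi>t, of "f \<otimes> g" a] by simp
    show "c (f, g) ?y \<cdot> farr (comp_functor C (S f) (S g)) a = farr (S (f \<otimes> g)) a \<cdot> c (f, g) ?x"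
      by (rule iso_cancel_left[of "\<phi> (f \<otimes> g) ?y"])
        (auto simp: c 1 comp_extend[OF 2] comp_extend[OF 3] comp_extend[OF 4])
  qed (auto simp: c c_def)
  then have c_nat: "is_nat_trans C C (comp_functor C (S f) (S g)) (S (f \<otimes> g)) (c (f, g))"
    if "f \<in> carrier G" "g \<in> carrier G" for f g using that by (simp add: is_nat_iso_def)
  note [simp] = nat_trans_arr[OF c_nat] nat_trans_dom[OF c_nat] nat_trans_cod[OF c_nat]
  have assoc: "c (f \<otimes> g, h) x \<cdot> c (f, g) (fobj (S h) x) = c (f, g \<otimes> h) x \<cdot> farr (S f) (c (g, h) x)"
    if [simp]: "f \<in> carrier G" "g \<in> carrier G" "h \<in> carrier G" "x \<in> Obj C" for f g h x
  proof (rule iso_cancel_left[of "\<phi> (f \<otimes> g \<otimes> h) x"])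
    have 1: "\<phi> (f \<otimes> g \<otimes> h) x \<cdot> c (f \<otimes> g, h) x = mulc T (f \<otimes> g, h) x \<cdot>
      \<phi> (f \<otimes> g) (fobj (act T h) x) \<cdot> farr (S (f \<otimes> g)) (\<phi> h x)"
      using comp[of "f \<otimes> g" h] by (simp add: compatible_def)
    have 2: "\<phi> (f \<otimes> g \<otimes> h) x \<cdot> c (f, g \<otimes> h) x = mulc T (f, g \<otimes> h) x \<cdot>
      \<phi> f (fobj (act T (g \<otimes> h)) x) \<cdot> farr (S f) (\<phi> (g \<otimes> h) x)"
      using comp[of f "g \<otimes> h"] by (simp add: compatible_def m_assoc)
    \<comment> \<open>Since \<open>compatible_triple\<close> speaks of a bare \<open>c\<close>,
      there is no circularity: with \<open>\<phi> (f \<otimes> g \<otimes> h) x\<close> in front,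
      the two sides of the coherence of \<open>c\<close> become the two sides of this
      equation.\<close>
    have "mulc T (f \<otimes> g, h) x \<cdot> \<phi> (f \<otimes> g) (fobj (act T h) x) \<cdot> farr (S (f \<otimes> g)) (\<phi> h x) \<cdot>
      c (f, g) (fobj (S h) x) = mulc T (f, g \<otimes> h) x \<cdot> \<phi> f (fobj (act T (g \<otimes> h)) x) \<cdot>
      farr (S f) (\<phi> (g \<otimes> h) x) \<cdot> farr (S f) (c (g, h) x)"
      by (rule compatible_triple) (auto simp: comp c_nat \<phi>t)
    then show "\<phi> (f \<otimes> g \<otimes> h) x \<cdot> c (f \<otimes> g, h) x \<cdot> c (f, g) (fobj (S h) x) =
      \<phi> (f \<otimes> g \<otimes> h) x \<cdot> c (f, g \<otimes> h) x \<cdot> farr (S f) (c (g, h) x)"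
      by (subst comp_extend[OF 1], simp, simp, simp, simp, simp,
          subst comp_extend[OF 2]) (simp_all add: m_assoc)
  qed (auto simp: m_assoc)
  have u: "is_nat_trans C C (act T \<one>) (id_functor C) (unitc T)"
    "\<And>x. x \<in> Obj C \<Longrightarrow> is_iso_arr C (unitc T x)"
    using unitc_nat_iso[OF T] by (auto simp: is_nat_iso_iff)
  note [simp] = u(2) nat_trans_dom[OF u(1)] nat_trans_cod[OF u(1)]
  have "is_nat_iso C C (S \<one>) (id_functor C) (unitc T')"
    unfolding is_nat_iso_iff
  proof (intro conjI ballI nat_transI)
    fix a assume [simp]: "a \<in> Arr C"
    have 1: "unitc T (Cod C a) \<cdot> farr (act T \<one>) a = a \<cdot> unitc T (Dom C a)"
      using nat_trans_natural[OF u(1), of a] by simp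
    have 2: "\<phi> \<one> (Cod C a) \<cdot> farr (S \<one>) a = farr (act T \<one>) a \<cdot> \<phi> \<one> (Dom C a)"
      using nat_trans_natural[OF \<phi>t, of \<one> a] by simp
    show "unitc T' (Cod C a) \<cdot> farr (S \<one>) a = farr (id_functor C) a \<cdot> unitc T' (Dom C a)"
      by (simp add: T'_def vcomp_def 2 comp_extend[OF 1])
  qed (auto simp: T'_def vcomp_def)
  then have act: "is_action C G T'"
    by (intro is_actionI) (auto simp: T' S c_iso assoc, auto simp: c_def)
  define m where "m = \<lparr>msrc = T', mtgt = T, mfam = (\<lambda>g\<in>carrier G. \<phi> g)\<rparr>"
  have "is_action_mor C G m"
    unfolding is_action_mor_iff m_def using act comp
    by (auto simp: T' \<phi>t compatible_def)
  then have "is_iso_arr (action_cat C G) m" by (rule action_mor_iso) (simp add: m_def)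
  then show ?thesis
    using that[OF act T'(1), of m] by (auto simp: T' c m_def action_cat_def)
qed

text \<open>Equality of functors, instead of isomorphism, makes composition with
  \<open>act T \<one>\<close> strictly trivial. Coherence propagates the second condition to all
  pairs containing \<open>\<one>\<close>.\<close>

definition normalised :: "('g, 'o, 'm) action \<Rightarrow> bool"
  where "normalised T \<longleftrightarrow> act T \<one> = id_functor C \<and> (\<forall>x\<in>Obj C. mulc T (\<one>, \<one>) x = Ident C x)"

lemma normalised_act_one [simp]: "normalised T \<Longrightarrow> act T \<one> = id_functor C"
  unfolding normalised_def by blast

lemma normalised_mulc_one [simp]: "normalised T \<Longrightarrow> x \<in> Obj C \<Longrightarrow> mulc T (\<one>, \<one>) x = Ident C x"
  unfolding normalised_def by blast

text \<open>Coherence at \<open>(\<one>, \<one>, g)\<close> says that this isomorphism is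
  idempotent, hence an identity. On the other side the triple \<open>(g, \<one>, \<one>)\<close>
  does the same.\<close>

lemma normalised_mulc_one_left [simp]:
  assumes "is_action C G T" "normalised T" "g \<in> carrier G" "x \<in> Obj C"
  shows "mulc T (\<one>, g) x = Ident C (fobj (act T g) x)"
proof (rule iso_cancel_left[of "mulc T (\<one>, g) x"])
  show "mulc T (\<one>, g) x \<cdot> mulc T (\<one>, g) x = mulc T (\<one>, g) x \<cdot> Ident C (fobj (act T g) x)"
    using mulc_assoc[of T \<one> \<one> g x, symmetric] assms by simp
qed (use assms in auto)

lemma normalised_mulc_one_right [simp]:
  assumes "is_action C G T" "normalised T" "g \<in> carrier G" "x \<in> Obj C"
  shows "mulc T (g, \<one>) x = Ident C (fobj (act T g) x)"
proof (rule iso_cancel_left[of "mulc T (g, \<one>) x"])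
  show "mulc T (g, \<one>) x \<cdot> mulc T (g, \<one>) x = mulc T (g, \<one>) x \<cdot> Ident C (fobj (act T g) x)"
    using mulc_assoc[of T g \<one> \<one> x] assms by simp
qed (use assms in auto)

text \<open>Compatibility at \<open>(\<one>, \<one>)\<close> makes the component idempotent, and the
  invertibility clause of \<open>is_action_mor\<close> leaves only the identity.\<close>

lemma normalised_mfam_one:
  assumes "is_action_mor C G m" "normalised (msrc m)" "normalised (mtgt m)" and x: "x \<in> Obj C"
  shows "mfam m \<one> x = Ident C x"
proof (rule iso_cancel_left[of "mfam m \<one> x"])
  have "mfam m \<one> x \<cdot> mfam m \<one> x = mfam m \<one> x"
    using mfam_mult[of m \<one> \<one> x, symmetric] assms by simp
  then show "mfam m \<one> x \<cdot> mfam m \<one> x = mfam m \<one> x \<cdot> Ident C x" using assms by simp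
qed (use assms in \<open>auto simp: mfam_one_iso\<close>)

lemma normalisation:
  assumes T: "is_action C G T"
  obtains T' m where "is_action C G T'" "normalised T'"
    "is_iso_arr (action_cat C G) m" "Dom (action_cat C G) m = T'" "Cod (action_cat C G) m = T"
proof -
  interpret A: category "action_cat C G" by (simp add: category_def action_cat_category)
  have u: "is_nat_trans C C (act T \<one>) (id_functor C) (unitc T)"
    "\<And>x. x \<in> Obj C \<Longrightarrow> is_iso_arr C (unitc T x)"
    using unitc_nat_iso[OF T] by (auto simp: is_nat_iso_iff)
  note [simp] = T u(2) nat_trans_dom[OF u(1)] nat_trans_cod[OF u(1)]
  \<comment> \<open>First transport: \<open>unitc T\<close> identifies \<open>act T \<one>\<close>
    with the identity functor; all other functors stay.\<close>
  define \<phi> where "\<phi> g = (if g = \<one> then \<lambda>x\<in>Obj C. inv_arr C (unitc T x) else id_nat C C (act T g))"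
    for g
  have "is_nat_iso C C (id_functor C) (act T \<one>) (\<lambda>x\<in>Obj C. inv_arr C (unitc T x))"
    unfolding is_nat_iso_iff
  proof (intro conjI ballI nat_transI)
    fix a assume [simp]: "a \<in> Arr C"
    have 1: "unitc T (Cod C a) \<cdot> farr (act T \<one>) a = a \<cdot> unitc T (Dom C a)"
      using nat_trans_natural[OF u(1), of a] by simp
    show "(\<lambda>x\<in>Obj C. inv_arr C (unitc T x)) (Cod C a) \<cdot> farr (id_functor C) a =
      farr (act T \<one>) a \<cdot> (\<lambda>x\<in>Obj C. inv_arr C (unitc T x)) (Dom C a)"
      by (rule iso_cancel_left[of "unitc T (Cod C a)"]) (auto simp: comp_extend[OF 1])
  qed auto
  then have "is_nat_iso C C (((act T)(\<one> := id_functor C)) g) (act T g) (\<phi> g)"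
    if "g \<in> carrier G" for g
    using that by (simp add: \<phi>_def id_nat_iso)
  moreover have "(act T)(\<one> := id_functor C) \<in> extensional (carrier G)"
    using act_ext[OF T] by (auto simp: extensional_def)
  ultimately obtain T1 m1 where T1 [simp]: "is_action C G T1"
    and act1: "act T1 = (act T)(\<one> := id_functor C)"
    and m1: "is_iso_arr (action_cat C G) m1"
      "Dom (action_cat C G) m1 = T1" "Cod (action_cat C G) m1 = T"
    using transport_action[OF T] by metis
  have [simp]: "act T1 \<one> = id_functor C" by (simp add: act1)
  \<comment> \<open>Second transport: the functors stay, and the identity element is rescaled by the
    inverse of \<open>u = mulc T1 (\<one>, \<one>)\<close>. The transport formula contains
    \<open>\<psi>\<close> twice and its inverse once, so the new value at
    \<open>(\<one>, \<one>)\<close> is \<open>u u u^-1 u^-1\<close>.\<close>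
  define \<psi> where "\<psi> g = (if g = \<one> then \<lambda>x\<in>Obj C. inv_arr C (mulc T1 (\<one>, \<one>) x)
    else id_nat C C (act T1 g))" for g
  have "is_nat_iso C C (id_functor C) (id_functor C) (\<lambda>x\<in>Obj C. inv_arr C (mulc T1 (\<one>, \<one>) x))"
    unfolding is_nat_iso_iff
  proof (intro conjI ballI nat_transI)
    fix a assume [simp]: "a \<in> Arr C"
    have 1: "mulc T1 (\<one>, \<one>) (Cod C a) \<cdot> a = a \<cdot> mulc T1 (\<one>, \<one>) (Dom C a)"
      using mulc_natural[OF T1, of \<one> \<one> a] by simp
    show "(\<lambda>x\<in>Obj C. inv_arr C (mulc T1 (\<one>, \<one>) x)) (Cod C a) \<cdot> farr (id_functor C) a =
      farr (id_functor C) a \<cdot> (\<lambda>x\<in>Obj C. inv_arr C (mulc T1 (\<one>, \<one>) x)) (Dom C a)"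
      by (rule iso_cancel_left[of "mulc T1 (\<one>, \<one>) (Cod C a)"]) (auto simp: comp_extend[OF 1])
  qed auto
  then have "is_nat_iso C C (act T1 g) (act T1 g) (\<psi> g)" if "g \<in> carrier G" for g
    using that by (simp add: \<psi>_def id_nat_iso)
  then obtain T2 m2 where T2 [simp]: "is_action C G T2" and act2: "act T2 = act T1"
    and mulc2: "\<And>f g x. \<lbrakk>f \<in> carrier G; g \<in> carrier G; x \<in> Obj C\<rbrakk> \<Longrightarrow> mulc T2 (f, g) x =
      inv_arr C (\<psi> (f \<otimes> g) x) \<cdot> mulc T1 (f, g) x \<cdot> \<psi> f (fobj (act T1 g) x) \<cdot> farr (act T1 f) (\<psi> g x)"
    and m2: "is_iso_arr (action_cat C G) m2"
      "Dom (action_cat C G) m2 = T2" "Cod (action_cat C G) m2 = T1"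
    using transport_action[OF T1 act_ext[OF T1]] by metis
  have "normalised T2"
    by (simp add: normalised_def act2 mulc2 \<psi>_def)
  moreover have "is_iso_arr (action_cat C G) (A.cmp m1 m2)"
    "Dom (action_cat C G) (A.cmp m1 m2) = T2" "Cod (action_cat C G) (A.cmp m1 m2) = T"
    using m1 m2 by auto
  ultimately show ?thesis using that[OF T2] by blast
qed

end

section \<open>Restriction\<close>

lemma prod_cat_category:
  assumes "is_category A" "is_category B"
  shows "is_category (prod_cat A B)"
proof -
  interpret A: category A using assms by (simp add: category_def)
  interpret B: category B using assms by (simp add: category_def)
  show ?thesis
    unfolding is_category_def prod_cat_def Hom_def cat.simps by auto
qed

lemma prod_cat_iso:
  assumes "is_category A" "is_category B" "is_iso_arr A a" "is_iso_arr B b"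
  shows "is_iso_arr (prod_cat A B) (a, b)"
proof -
  interpret A: category A using assms by (simp add: category_def)
  interpret B: category B using assms by (simp add: category_def)
  interpret P: category "prod_cat A B"
    using prod_cat_category[OF assms(1,2)] by (simp add: category_def)
  show ?thesis
    by (rule P.is_iso_arrI[where g = "(inv_arr A a, inv_arr B b)"])
      (use assms in \<open>auto simp: prod_cat_def\<close>)
qed

lemma restrict_action_simps [simp]:
  "g \<in> carrier G \<Longrightarrow> act (restrict_action G i T) g = act T (i g)"
  "f \<in> carrier G \<Longrightarrow> g \<in> carrier G \<Longrightarrow> mulc (restrict_action G i T) (f, g) = mulc T (i f, i g)"
  "unitc (restrict_action G i T) = unitc T"
  by (simp_all add: restrict_action_def)

lemma restrict_action_mor_simps [simp]:
  "msrc (restrict_action_mor G i m) = restrict_action G i (msrc m)"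
  "mtgt (restrict_action_mor G i m) = restrict_action G i (mtgt m)"
  "g \<in> carrier G \<Longrightarrow> mfam (restrict_action_mor G i m) g = mfam m (i g)"
  by (simp_all add: restrict_action_mor_def)

locale monoid_restriction = G: cat_monoid C G + H: cat_monoid C H
  for C :: "('o, 'm) cat" and G :: "('g, 'x) monoid_scheme" and H :: "('h, 'y) monoid_scheme" +
  fixes i :: "'g \<Rightarrow> 'h"
  assumes map_closed [simp]: "g \<in> carrier G \<Longrightarrow> i g \<in> carrier H"
    and map_mult [simp]: "f \<in> carrier G \<Longrightarrow> g \<in> carrier G \<Longrightarrow> i (f \<otimes>\<^bsub>G\<^esub> g) = i f \<otimes>\<^bsub>H\<^esub> i g"
    and map_one [simp]: "i \<one>\<^bsub>G\<^esub> = \<one>\<^bsub>H\<^esub>"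
begin

lemma restrict_action:
  assumes T [simp]: "is_action C H T"
  shows "is_action C G (restrict_action G i T)"
proof (rule G.is_actionI)
  show "act (restrict_action G i T) \<in> extensional (carrier G)"
    "mulc (restrict_action G i T) \<in> extensional (carrier G \<times> carrier G)"
    by (auto simp: restrict_action_def)
qed (auto simp: H.mulc_nat_iso H.unitc_nat_iso H.mulc_assoc)

lemma restrict_action_mor:
  assumes m [simp]: "is_action_mor C H m"
  shows "is_action_mor C G (restrict_action_mor G i m)"
proof -
  have "G.compatible (act (restrict_action G i (msrc m))) (mulc (restrict_action G i (msrc m)))
     (restrict_action G i (mtgt m)) (mfam (restrict_action_mor G i m)) f g"
    if "f \<in> carrier G" "g \<in> carrier G" for f g
    using H.mfam_mult[OF m] that by (simp add: G.compatible_def)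
  then show ?thesis
    unfolding G.is_action_mor_iff
    by (auto simp: restrict_action H.mfam_nat[OF m] H.mfam_one_iso[OF m],
      auto simp: restrict_action_mor_def)
qed

lemma restrict_ident:
  assumes "is_action C H T"
  shows "restrict_action_mor G i (Ident (action_cat C H) T) =
    Ident (action_cat C G) (restrict_action G i T)"
  by (auto simp: action_cat_def restrict_action_mor_def cong: restrict_cong)

lemma restrict_comp:
  "restrict_action_mor G i (Comp (action_cat C H) n m) =
    Comp (action_cat C G) (restrict_action_mor G i n) (restrict_action_mor G i m)"
  by (auto simp: action_cat_def restrict_action_mor_def cong: restrict_cong)

lemma restrict_normalised:
  "H.normalised T \<Longrightarrow> G.normalised (restrict_action G i T)"
  by (simp add: G.normalised_def)

end

section \<open>Free products\<close>

locale two_monoids = G: monoid G + H: monoid H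
  for G :: "('a, 'x) monoid_scheme" and H :: "('b, 'y) monoid_scheme"
begin

definition letters :: "('a + 'b) set"
  where "letters = carrier G <+> carrier H"

fun letter_one :: "'a + 'b \<Rightarrow> bool"
  where
    "letter_one (Inl a) \<longleftrightarrow> a = \<one>\<^bsub>G\<^esub>"
  | "letter_one (Inr b) \<longleftrightarrow> b = \<one>\<^bsub>H\<^esub>"

text \<open>Only meaningful for two letters of the same factor.\<close>

fun lmul :: "'a + 'b \<Rightarrow> 'a + 'b \<Rightarrow> 'a + 'b"
  where
    "lmul (Inl a) (Inl a') = Inl (a \<otimes>\<^bsub>G\<^esub> a')"
  | "lmul (Inr b) (Inr b') = Inr (b \<otimes>\<^bsub>H\<^esub> b')"
  | "lmul x y = x"

text \<open>Extends \<open>letter_mult\<close> to identity letters, so that every element of a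
  factor acts on words.\<close>

definition push :: "'a + 'b \<Rightarrow> ('a + 'b) list \<Rightarrow> ('a + 'b) list"
  where "push x t = (if letter_one x then t else letter_mult G H x t)"

definition starts :: "'a + 'b \<Rightarrow> ('a + 'b) list \<Rightarrow> bool"
  where "starts x t \<longleftrightarrow> t \<noteq> [] \<and> isl (hd t) = isl x"

abbreviation words :: "('a + 'b) list set"
  where "words \<equiv> reduced_words G H"

lemma lmul_letters [simp]:
  assumes "x \<in> letters" "y \<in> letters" "isl x = isl y"
  shows "lmul x y \<in> letters" "isl (lmul x y) = isl y"
  using assms by (cases x; cases y; auto simp: letters_def)+

lemma lmul_assoc:
  assumes "x \<in> letters" "y \<in> letters" "z \<in> letters" "isl x = isl y" "isl y = isl z"
  shows "lmul (lmul x y) z = lmul x (lmul y z)"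
  using assms by (cases x; cases y; cases z; auto simp: letters_def G.m_assoc H.m_assoc)

lemma lmul_one [simp]:
  assumes "x \<in> letters" "y \<in> letters" "isl x = isl y" "letter_one x"
  shows "lmul x y = y" "lmul y x = y"
  using assms by (cases x; cases y; auto simp: letters_def)+

lemma letter_mult_Cons:
  "letter_mult G H x (y # t) =
    (if isl x = isl y then if letter_one (lmul x y) then t else lmul x y # t else x # y # t)"
  by (cases x; cases y) auto

lemma Nil_words [simp]: "[] \<in> words"
  by (simp add: reduced_words_def)

lemma Cons_words [simp]:
  "x # t \<in> words \<longleftrightarrow> x \<in> letters \<and> \<not> letter_one x \<and> t \<in> words \<and> \<not> starts x t"
  by (cases x; cases t) (auto simp: reduced_words_def letters_def starts_def)

lemma push_not_starts: "\<not> starts x t \<Longrightarrow> push x t = (if letter_one x then t else x # t)"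
  by (cases t; cases x) (auto simp: push_def starts_def letter_mult_Cons)

lemma starts_cong: "isl x = isl y \<Longrightarrow> starts x t = starts y t"
  by (simp add: starts_def)

text \<open>If \<open>t\<close> does not start in the factor of \<open>x\<close>, the identity
  letter of that factor serves as \<open>y\<close>. Thus a leading letter in any prescribed factor
  can always be split off.\<close>

lemma words_decompose:
  assumes "x \<in> letters" "t \<in> words"
  obtains y t0 where "y \<in> letters" "isl y = isl x" "t0 \<in> words" "\<not> starts x t0" "t = push y t0"
proof (cases "starts x t")
  case True
  then obtain y t0 where t: "t = y # t0" "isl y = isl x" by (cases t) (auto simp: starts_def)
  moreover have "\<not> starts x t0" "\<not> starts y t0"
    using assms t by (auto simp: starts_cong[of y x])
  ultimately show ?thesis using that[of y t0] assms by (auto simp: push_not_starts)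
next
  case False
  define y :: "'a + 'b" where "y = (if isl x then Inl \<one>\<^bsub>G\<^esub> else Inr \<one>\<^bsub>H\<^esub>)"
  have "y \<in> letters" "isl y = isl x" "letter_one y" by (auto simp: y_def letters_def)
  then show ?thesis using that[of y t] False assms by (auto simp: push_def)
qed

lemma push_push_not_starts:
  assumes "x \<in> letters" "y \<in> letters" "isl x = isl y" "\<not> starts x t"
  shows "push x (push y t) = push (lmul x y) t"
proof -
  have "\<not> starts y t" "\<not> starts (lmul x y) t"
    using assms starts_cong[of x y] starts_cong[of "lmul x y" y] by auto
  then show ?thesis
    using assms by (auto simp: push_not_starts) (auto simp: push_def letter_mult_Cons)
qed

text \<open>Splitting a leading letter \<open>z\<close> off \<open>t\<close> reduces this to
  associativity for \<open>x\<close>, \<open>y\<close>, \<open>z\<close> inside one factor. As in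
  van der Waerden's construction of free products, the action of the factors on reduced words yields
  associativity of the word product.\<close>

lemma push_push:
  assumes x: "x \<in> letters" and y: "y \<in> letters" and xy: "isl x = isl y" and t: "t \<in> words"
  shows "push x (push y t) = push (lmul x y) t"
proof -
  obtain z t0 where z: "z \<in> letters" "isl z = isl x" "t0 \<in> words" "\<not> starts x t0" "t = push z t0"
    using words_decompose[OF x t] by blast
  have "\<not> starts y t0" "\<not> starts (lmul x y) t0"
    using assms z starts_cong[of x y] starts_cong[of "lmul x y" y] by auto
  then show ?thesis using assms z by (simp add: push_push_not_starts lmul_assoc)
qed

lemma push_words [simp]:
  assumes x: "x \<in> letters" and t: "t \<in> words"
  shows "push x t \<in> words"
proof -
  obtain z t0 where z: "z \<in> letters" "isl z = isl x" "t0 \<in> words" "\<not> starts x t0" "t = push z t0"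
    using words_decompose[OF x t] by blast
  have "\<not> starts (lmul x z) t0" using z x starts_cong[of "lmul x z" x] by auto
  then show ?thesis using x z by (simp add: push_push_not_starts push_not_starts)
qed

abbreviation P :: "('a + 'b) list monoid"
  where "P \<equiv> free_prod G H"

lemma carrier_P [simp]: "carrier P = words"
  and one_P [simp]: "\<one>\<^bsub>P\<^esub> = []"
  and Nil_mult [simp]: "[] \<otimes>\<^bsub>P\<^esub> w = w"
  by (simp_all add: free_prod_def)

lemma Cons_mult [simp]: "\<not> letter_one x \<Longrightarrow> (x # v) \<otimes>\<^bsub>P\<^esub> w = push x (v \<otimes>\<^bsub>P\<^esub> w)"
  by (simp add: free_prod_def push_def)

lemma mult_words [simp]: "v \<in> words \<Longrightarrow> w \<in> words \<Longrightarrow> v \<otimes>\<^bsub>P\<^esub> w \<in> words"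
  by (induction v) auto

lemma push_not_starts_mult:
  "\<not> starts x t \<Longrightarrow> push x t \<otimes>\<^bsub>P\<^esub> w = push x (t \<otimes>\<^bsub>P\<^esub> w)"
  by (simp add: push_not_starts) (simp add: push_def)

text \<open>The induction step of \<open>mult_assoc\<close>, where \<open>x\<close> may merge with
  or cancel the head of \<open>t\<close>; splitting off that head turns both sides into a single
  \<open>push\<close> by \<open>lmul x z\<close>.\<close>

lemma push_mult:
  assumes x: "x \<in> letters" and t: "t \<in> words" and w: "w \<in> words"
  shows "push x t \<otimes>\<^bsub>P\<^esub> w = push x (t \<otimes>\<^bsub>P\<^esub> w)"
proof -
  obtain z t0 where z: "z \<in> letters" "isl z = isl x" "t0 \<in> words" "\<not> starts x t0" "t = push z t0"
    using words_decompose[OF x t] by blast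
  have "\<not> starts (lmul x z) t0" "\<not> starts z t0"
    using z x starts_cong[of "lmul x z" x] starts_cong[of z x] by auto
  then show ?thesis using x z w by (simp add: push_push push_not_starts_mult)
qed

lemma mult_assoc: "\<lbrakk>u \<in> words; v \<in> words; w \<in> words\<rbrakk> \<Longrightarrow> (u \<otimes>\<^bsub>P\<^esub> v) \<otimes>\<^bsub>P\<^esub> w = u \<otimes>\<^bsub>P\<^esub> (v \<otimes>\<^bsub>P\<^esub> w)"
  by (induction u) (auto simp: push_mult)

lemma mult_Nil: "v \<in> words \<Longrightarrow> v \<otimes>\<^bsub>P\<^esub> [] = v"
  by (induction v) (auto simp: push_not_starts)

lemma monoid_P: "monoid P"
  by (rule monoidI) (auto simp: mult_assoc mult_Nil)

lemma push_Nil_mult: "push x [] \<otimes>\<^bsub>P\<^esub> w = push x w"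
  by (cases x) (auto simp: push_def free_prod_def)

lemma in_left_eq: "in_left G a = push (Inl a) []"
  and in_right_eq: "in_right H b = push (Inr b) []"
  by (auto simp: in_left_def in_right_def push_def)

lemma Inl_letters [simp]: "Inl a \<in> letters \<longleftrightarrow> a \<in> carrier G"
  and Inr_letters [simp]: "Inr b \<in> letters \<longleftrightarrow> b \<in> carrier H"
  by (auto simp: letters_def)

text \<open>Its instances for the two factors say that \<open>in_left\<close> and
  \<open>in_right\<close> are multiplicative.\<close>

lemma push_Nil_lmul:
  assumes "x \<in> letters" "y \<in> letters" "isl x = isl y"
  shows "push (lmul x y) [] = push x [] \<otimes>\<^bsub>P\<^esub> push y []"
  using assms by (simp add: push_Nil_mult push_push)

end

locale cat_two_monoids = category C + two_monoids G H
  for C :: "('o, 'm) cat" and G :: "('a, 'x) monoid_scheme" and H :: "('b, 'y) monoid_scheme"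
begin

sublocale G: cat_monoid C G ..
sublocale H: cat_monoid C H ..
sublocale P: cat_monoid C P
  by (simp add: cat_monoid_def category_axioms monoid_P)

sublocale left: monoid_restriction C G P "in_left G"
proof
  fix f g assume "f \<in> carrier G" "g \<in> carrier G"
  then show "in_left G (f \<otimes>\<^bsub>G\<^esub> g) = in_left G f \<otimes>\<^bsub>P\<^esub> in_left G g"
    using push_Nil_lmul[of "Inl f" "Inl g"] by (simp add: in_left_eq)
qed (auto simp: in_left_eq, simp add: push_def)

sublocale right: monoid_restriction C H P "in_right H"
proof
  fix f g assume "f \<in> carrier H" "g \<in> carrier H"
  then show "in_right H (f \<otimes>\<^bsub>H\<^esub> g) = in_right H f \<otimes>\<^bsub>P\<^esub> in_right H g"
    using push_Nil_lmul[of "Inr f" "Inr g"] by (simp add: in_right_eq)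
qed (auto simp: in_right_eq, simp add: push_def)

abbreviation actions_prod
  where "actions_prod \<equiv> prod_cat (action_cat C G) (action_cat C H)"

lemma actions_prod_category: "is_category actions_prod"
  by (intro prod_cat_category G.action_cat_category H.action_cat_category)

lemma restriction_functor: "is_functor (action_cat C P) actions_prod (restriction_functor C G H)"
proof (rule is_functorI)
  fix T assume "T \<in> Obj (action_cat C P)"
  then have [simp]: "is_action C P T" by (simp add: action_cat_def)
  interpret A: category "action_cat C P" by (simp add: category_def P.action_cat_category)
  have "Ident (action_cat C P) T \<in> Arr (action_cat C P)"
    using P.is_action_mor_ident[of T] by (simp add: action_cat_def)
  then show "farr (restriction_functor C G H) (Ident (action_cat C P) T) =
    Ident actions_prod (fobj (restriction_functor C G H) T)"
    by (simp add: restriction_functor_def left.restrict_ident right.restrict_ident prod_cat_def)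
      (simp add: action_cat_def)
next
  interpret A: category "action_cat C P" by (simp add: category_def P.action_cat_category)
  fix m n assume "m \<in> Arr (action_cat C P)" "n \<in> Arr (action_cat C P)"
    "Dom (action_cat C P) n = Cod (action_cat C P) m"
  then show "farr (restriction_functor C G H) (Comp (action_cat C P) n m) =
    Comp actions_prod (farr (restriction_functor C G H) n) (farr (restriction_functor C G H) m)"
    by (simp add: restriction_functor_def left.restrict_comp right.restrict_comp prod_cat_def)
qed (rule P.action_cat_category, rule actions_prod_category,
    auto simp: restriction_functor_def prod_cat_def
    action_cat_def left.restrict_action right.restrict_action
    left.restrict_action_mor right.restrict_action_mor)

end

section \<open>Gluing two normalised actions\<close>

locale normalised_pair = cat_two_monoids +
  fixes A :: "('c, 'a, 'b) action" and B :: "('e, 'a, 'b) action"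
  assumes action_A [simp]: "is_action C G A" and action_B [simp]: "is_action C H B"
    and normalised_A [simp]: "G.normalised A" and normalised_B [simp]: "H.normalised B"
begin

fun lact where
    "lact (Inl a) = act A a"
  | "lact (Inr b) = act B b"

text \<open>Only meaningful for two letters of the same factor.\<close>

fun lmulc where
    "lmulc (Inl a) (Inl a') = mulc A (a, a')"
  | "lmulc (Inr b) (Inr b') = mulc B (b, b')"
  | "lmulc x y = undefined"

lemma lact_functor [simp]: "x \<in> letters \<Longrightarrow> is_functor C C (lact x)"
  by (cases x) auto

lemma lact_one [simp]: "letter_one x \<Longrightarrow> lact x = id_functor C"
  by (cases x) auto

lemma
  assumes "x \<in> letters" "y \<in> letters" "isl x = isl y" "X \<in> Obj C"
  shows lmulc_iso [simp]: "is_iso_arr C (lmulc x y X)"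
    and dom_lmulc [simp]: "Dom C (lmulc x y X) = fobj (lact x) (fobj (lact y) X)"
    and cod_lmulc [simp]: "Cod C (lmulc x y X) = fobj (lact (lmul x y)) X"
    and lmulc_one_left [simp]: "letter_one x \<Longrightarrow> lmulc x y X = Ident C (fobj (lact y) X)"
    and lmulc_one_right [simp]: "letter_one y \<Longrightarrow> lmulc x y X = Ident C (fobj (lact x) X)"
  using assms by (cases x; cases y; simp)+

lemma lmulc_natural:
  assumes "x \<in> letters" "y \<in> letters" "isl x = isl y" "a \<in> Arr C" "Dom C a = X" "Cod C a = Y"
  shows "lmulc x y Y \<cdot> farr (lact x) (farr (lact y) a) = farr (lact (lmul x y)) a \<cdot> lmulc x y X"
  using assms by (cases x; cases y) (auto simp: G.mulc_natural H.mulc_natural)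

lemma lmulc_assoc:
  assumes "x \<in> letters" "y \<in> letters" "z \<in> letters" "isl x = isl y" "isl y = isl z" "X \<in> Obj C"
  shows "lmulc (lmul x y) z X \<cdot> lmulc x y (fobj (lact z) X) =
    lmulc x (lmul y z) X \<cdot> farr (lact x) (lmulc y z X)"
  using assms by (cases x; cases y; cases z) (auto simp: G.mulc_assoc H.mulc_assoc)

section \<open>The functor of a word, and multiplication by a letter\<close>

primrec wact where
    "wact [] = id_functor C"
  | "wact (x # w) = comp_functor C (lact x) (wact w)"

lemma wact_functor [simp]: "w \<in> words \<Longrightarrow> is_functor C C (wact w)"
  by (induction w) auto

lemma wact_push_not_starts [simp]:
  assumes "x \<in> letters" "t \<in> words" "\<not> starts x t"
  shows "wact (push x t) = comp_functor C (lact x) (wact t)"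
  using assms by (auto simp: push_not_starts)

text \<open>The canonical isomorphism from \<open>lact x \<circ> wact t\<close> to \<open>wact (push x t)\<close>.\<close>

definition lw where
  "lw x t X = (if starts x t then lmulc x (hd t) (fobj (wact (tl t)) X)
    else Ident C (fobj (lact x) (fobj (wact t) X)))"

text \<open>Normalisation enters here: for an identity letter \<open>y\<close> the word is
  \<open>t\<close> itself, \<open>lw\<close> is an identity by definition, and
  \<open>lmulc x y\<close> is one because \<open>A\<close> and \<open>B\<close> are
  normalised.\<close>

lemma lw_push:
  assumes "x \<in> letters" "y \<in> letters" "isl y = isl x" "t \<in> words" "\<not> starts x t" "X \<in> Obj C"
  shows "lw x (push y t) X = lmulc x y (fobj (wact t) X)"
proof -
  have "\<not> starts y t" using assms starts_cong[of y x] by auto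
  then show ?thesis using assms by (auto simp: push_not_starts lw_def) (auto simp: starts_def)
qed

text \<open>Every word is \<open>push y t\<close> with \<open>t\<close> not starting in the factor of a given letter; this turns
  statements about \<open>lw\<close> into statements about \<open>lmulc\<close> without case distinctions on cancellation.\<close>

lemma words_decompose':
  assumes "x \<in> letters" "t \<in> words"
  obtains y t0 where "y \<in> letters" "isl y = isl x" "t0 \<in> words" "\<not> starts x t0" "\<not> starts y t0"
    "\<And>z. z \<in> letters \<Longrightarrow> isl z = isl x \<Longrightarrow> \<not> starts (lmul z y) t0"
    "t = push y t0"
proof -
  obtain y t0 where y: "y \<in> letters" "isl y = isl x" "t0 \<in> words" "\<not> starts x t0" "t = push y t0"
    using words_decompose[OF assms] by blast
  moreover have "\<not> starts (lmul z y) t0" if "z \<in> letters" "isl z = isl x" for z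
    using starts_cong[of "lmul z y" x] that y by simp
  moreover have "\<not> starts y t0" using starts_cong[of y x] y by simp
  ultimately show ?thesis using that by blast
qed

lemma
  assumes x: "x \<in> letters" and t: "t \<in> words" and X: "X \<in> Obj C"
  shows lw_iso [simp]: "is_iso_arr C (lw x t X)"
    and dom_lw [simp]: "Dom C (lw x t X) = fobj (lact x) (fobj (wact t) X)"
    and cod_lw [simp]: "Cod C (lw x t X) = fobj (wact (push x t)) X"
    and lw_one [simp]: "letter_one x \<Longrightarrow> lw x t X = Ident C (fobj (wact t) X)"
proof -
  obtain y t0 where y: "y \<in> letters" "isl y = isl x" "t0 \<in> words" "\<not> starts x t0" "\<not> starts y t0"
    "\<And>z. z \<in> letters \<Longrightarrow> isl z = isl x \<Longrightarrow> \<not> starts (lmul z y) t0" "t = push y t0"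
    using words_decompose'[OF x t] by blast
  show "is_iso_arr C (lw x t X)" "Dom C (lw x t X) = fobj (lact x) (fobj (wact t) X)"
    "Cod C (lw x t X) = fobj (wact (push x t)) X"
    "letter_one x \<Longrightarrow> lw x t X = Ident C (fobj (wact t) X)"
    using x y X by (auto simp: lw_push push_push)
qed

lemma lw_natural:
  assumes x: "x \<in> letters" and t: "t \<in> words" and a: "a \<in> Arr C" "Dom C a = X" "Cod C a = Y"
  shows "lw x t Y \<cdot> farr (lact x) (farr (wact t) a) = farr (wact (push x t)) a \<cdot> lw x t X"
proof -
  obtain y t0 where y: "y \<in> letters" "isl y = isl x" "t0 \<in> words" "\<not> starts x t0" "\<not> starts y t0"
    "\<And>z. z \<in> letters \<Longrightarrow> isl z = isl x \<Longrightarrow> \<not> starts (lmul z y) t0" "t = push y t0"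
    using words_decompose'[OF x t] by blast
  have "X \<in> Obj C" "Y \<in> Obj C" using a by auto
  then show ?thesis using x y a by (simp add: lw_push push_push lmulc_natural)
qed

text \<open>With the leading letter \<open>z\<close> split off \<open>t\<close>, this is coherence
  at \<open>(x, y, z)\<close> in a single factor.\<close>

lemma lw_assoc:
  assumes x: "x \<in> letters" and y: "y \<in> letters" "isl x = isl y" and t: "t \<in> words" and X: "X \<in> Obj C"
  shows "lw x (push y t) X \<cdot> farr (lact x) (lw y t X) =
    lw (lmul x y) t X \<cdot> lmulc x y (fobj (wact t) X)"
proof -
  obtain z t0 where z: "z \<in> letters" "isl z = isl x" "t0 \<in> words" "\<not> starts x t0" "\<not> starts z t0"
    "\<And>u. u \<in> letters \<Longrightarrow> isl u = isl x \<Longrightarrow> \<not> starts (lmul u z) t0" "t = push z t0"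
    using words_decompose'[OF x t] by blast
  have "\<not> starts y t0" "\<not> starts (lmul x y) t0"
    using z x y starts_cong[of y x] starts_cong[of "lmul x y" x] by auto
  then show ?thesis using x y z X by (simp add: lw_push push_push lmulc_assoc)
qed

section \<open>The structure isomorphisms for pairs of words\<close>

primrec wmulc where
    "wmulc [] w X = Ident C (fobj (wact w) X)"
  | "wmulc (x # v) w X = lw x (v \<otimes>\<^bsub>P\<^esub> w) X \<cdot> farr (lact x) (wmulc v w X)"

lemma wmulc_props:
  assumes "v \<in> words" "w \<in> words" "X \<in> Obj C"
  shows "is_iso_arr C (wmulc v w X) \<and> Dom C (wmulc v w X) = fobj (wact v) (fobj (wact w) X) \<and>
    Cod C (wmulc v w X) = fobj (wact (v \<otimes>\<^bsub>P\<^esub> w)) X"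
  using assms by (induction v) auto

lemma
  assumes "v \<in> words" "w \<in> words" "X \<in> Obj C"
  shows wmulc_iso [simp]: "is_iso_arr C (wmulc v w X)"
    and dom_wmulc [simp]: "Dom C (wmulc v w X) = fobj (wact v) (fobj (wact w) X)"
    and cod_wmulc [simp]: "Cod C (wmulc v w X) = fobj (wact (v \<otimes>\<^bsub>P\<^esub> w)) X"
  using wmulc_props[OF assms] by auto

lemma wmulc_natural:
  assumes "v \<in> words" "w \<in> words" "a \<in> Arr C"
  shows "wmulc v w (Cod C a) \<cdot> farr (wact v) (farr (wact w) a) =
    farr (wact (v \<otimes>\<^bsub>P\<^esub> w)) a \<cdot> wmulc v w (Dom C a)"
  using assms(1)
proof (induction v)
  case (Cons x v)
  then have [simp]: "x \<in> letters" "v \<in> words" "\<not> letter_one x" by auto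
  note [simp] = assms(2,3)
  have 1: "wmulc v w (Cod C a) \<cdot> farr (wact v) (farr (wact w) a) =
    farr (wact (v \<otimes>\<^bsub>P\<^esub> w)) a \<cdot> wmulc v w (Dom C a)"
    using Cons by simp
  have 2: "farr (lact x) (wmulc v w (Cod C a)) \<cdot> farr (lact x) (farr (wact v) (farr (wact w) a)) =
    farr (lact x) (farr (wact (v \<otimes>\<^bsub>P\<^esub> w)) a) \<cdot> farr (lact x) (wmulc v w (Dom C a))"
    using arg_cong[OF 1, of "farr (lact x)"] by simp
  have 3: "lw x (v \<otimes>\<^bsub>P\<^esub> w) (Cod C a) \<cdot> farr (lact x) (farr (wact (v \<otimes>\<^bsub>P\<^esub> w)) a) =
    farr (wact (push x (v \<otimes>\<^bsub>P\<^esub> w))) a \<cdot> lw x (v \<otimes>\<^bsub>P\<^esub> w) (Dom C a)"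
    by (rule lw_natural) auto
  show ?case by (simp add: 2 comp_extend[OF 3])
qed (use assms in simp)

lemma wmulc_push_not_starts:
  assumes "z \<in> letters" "t \<in> words" "\<not> starts z t" "w \<in> words" "X \<in> Obj C"
  shows "wmulc (push z t) w X = lw z (t \<otimes>\<^bsub>P\<^esub> w) X \<cdot> farr (lact z) (wmulc t w X)"
  using assms by (auto simp: push_not_starts)

text \<open>Extends the recursion of \<open>wmulc\<close> from \<open>x # t\<close> to
  \<open>push x t\<close>, where \<open>x\<close> may merge with or cancel the head \<open>y\<close>
  of \<open>t\<close>. The two letters are multiplied first, by naturality of
  \<open>lmulc x y\<close> and \<open>lw_assoc\<close>.\<close>

lemma wmulc_push:
  assumes x: "x \<in> letters" and t: "t \<in> words" and u: "u \<in> words" and X: "X \<in> Obj C"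
  shows "wmulc (push x t) u X \<cdot> lw x t (fobj (wact u) X) =
    lw x (t \<otimes>\<^bsub>P\<^esub> u) X \<cdot> farr (lact x) (wmulc t u X)"
proof -
  obtain y t0 where y: "y \<in> letters" "isl y = isl x" "t0 \<in> words" "\<not> starts x t0" "\<not> starts y t0"
    "\<And>z. z \<in> letters \<Longrightarrow> isl z = isl x \<Longrightarrow> \<not> starts (lmul z y) t0" and t: "t = push y t0"
    using words_decompose'[OF x t] by blast
  note [simp] = x u X y push_push lw_push push_mult wmulc_push_not_starts
  have 1: "farr (lact (lmul x y)) (wmulc t0 u X) \<cdot> lmulc x y (fobj (wact t0) (fobj (wact u) X)) =
    lmulc x y (fobj (wact (t0 \<otimes>\<^bsub>P\<^esub> u)) X) \<cdot> farr (lact x) (farr (lact y) (wmulc t0 u X))"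
    by (rule lmulc_natural[symmetric]) auto
  have 2: "lw (lmul x y) (t0 \<otimes>\<^bsub>P\<^esub> u) X \<cdot> lmulc x y (fobj (wact (t0 \<otimes>\<^bsub>P\<^esub> u)) X) =
    lw x (push y (t0 \<otimes>\<^bsub>P\<^esub> u)) X \<cdot> farr (lact x) (lw y (t0 \<otimes>\<^bsub>P\<^esub> u) X)"
    by (rule lw_assoc[symmetric]) auto
  show ?thesis by (simp add: t 1 comp_extend[OF 2])
qed

lemma wmulc_assoc:
  assumes "v \<in> words" "w \<in> words" "u \<in> words" "X \<in> Obj C"
  shows "wmulc (v \<otimes>\<^bsub>P\<^esub> w) u X \<cdot> wmulc v w (fobj (wact u) X) =
    wmulc v (w \<otimes>\<^bsub>P\<^esub> u) X \<cdot> farr (wact v) (wmulc w u X)"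
  using assms(1)
proof (induction v)
  case (Cons x v)
  then have [simp]: "x \<in> letters" "v \<in> words" "\<not> letter_one x" by auto
  note [simp] = assms(2-4) mult_assoc
  have 1: "wmulc (v \<otimes>\<^bsub>P\<^esub> w) u X \<cdot> wmulc v w (fobj (wact u) X) =
    wmulc v (w \<otimes>\<^bsub>P\<^esub> u) X \<cdot> farr (wact v) (wmulc w u X)"
    using Cons by simp
  have 2: "farr (lact x) (wmulc (v \<otimes>\<^bsub>P\<^esub> w) u X) \<cdot> farr (lact x) (wmulc v w (fobj (wact u) X)) =
    farr (lact x) (wmulc v (w \<otimes>\<^bsub>P\<^esub> u) X) \<cdot> farr (lact x) (farr (wact v) (wmulc w u X))"
    using arg_cong[OF 1, of "farr (lact x)"] by simp
  \<comment> \<open>The product of \<open>x # v\<close> and \<open>w\<close> is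
    \<open>push x\<close> of a word that may start in the factor of \<open>x\<close>, so the
    recursion of \<open>wmulc\<close> does not apply and \<open>wmulc_push\<close> takes its
    place.\<close>
  have 3: "wmulc (push x (v \<otimes>\<^bsub>P\<^esub> w)) u X \<cdot> lw x (v \<otimes>\<^bsub>P\<^esub> w) (fobj (wact u) X) =
    lw x (v \<otimes>\<^bsub>P\<^esub> (w \<otimes>\<^bsub>P\<^esub> u)) X \<cdot> farr (lact x) (wmulc (v \<otimes>\<^bsub>P\<^esub> w) u X)"
    using wmulc_push[of x "v \<otimes>\<^bsub>P\<^esub> w" u X] by simp
  show ?case by (simp add: comp_extend[OF 3] 2)
qed (use assms in simp)

text \<open>Restrictions of one action share their \<open>unitc\<close>, whereas
  \<open>unitc A\<close> and \<open>unitc B\<close> may differ; the identity is chosen, and the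
  restrictions are compared with \<open>A\<close> and \<open>B\<close> through
  \<open>action_iso_if_eq\<close>.\<close>

definition glued where
  "glued = \<lparr>act = (\<lambda>w\<in>words. wact w), mulc = (\<lambda>(v, w)\<in>words \<times> words. \<lambda>X\<in>Obj C. wmulc v w X),
    unitc = id_nat C C (id_functor C)\<rparr>"

lemma glued_simps [simp]:
  "w \<in> words \<Longrightarrow> act glued w = wact w"
  "v \<in> words \<Longrightarrow> w \<in> words \<Longrightarrow> mulc glued (v, w) = (\<lambda>X\<in>Obj C. wmulc v w X)"
  by (simp_all add: glued_def)

lemma glued_action: "is_action C P glued"
proof (rule P.is_actionI)
  show "act glued \<in> extensional (carrier P)" "mulc glued \<in> extensional (carrier P \<times> carrier P)"
    by (simp_all add: glued_def)
  show "is_nat_iso C C (act glued \<one>\<^bsub>P\<^esub>) (id_functor C) (unitc glued)"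
    using id_nat_iso[of "id_functor C"] by (simp add: glued_def)
  show "is_nat_iso C C (comp_functor C (act glued v) (act glued w)) (act glued (v \<otimes>\<^bsub>P\<^esub> w))
    (mulc glued (v, w))" if "v \<in> carrier P" "w \<in> carrier P" for v w
    unfolding is_nat_iso_iff using that
    by (auto intro!: nat_transI simp: wmulc_natural)
qed (auto simp: wmulc_assoc)

lemma glued_act_push: "x \<in> letters \<Longrightarrow> act glued (push x []) = lact x"
  by (simp add: starts_def)

lemma glued_mulc_push:
  assumes "x \<in> letters" "y \<in> letters" "isl x = isl y" "X \<in> Obj C"
  shows "mulc glued (push x [], push y []) X = lmulc x y X"
proof -
  have "\<not> starts x []" "\<not> starts y []" by (simp_all add: starts_def)
  then show ?thesis using assms by (simp add: wmulc_push_not_starts lw_push)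
qed

lemma glued_iso:
  obtains m where "is_iso_arr actions_prod m"
    "Dom actions_prod m = fobj (restriction_functor C G H) glued" "Cod actions_prod m = (A, B)"
proof -
  obtain m1 where m1: "is_iso_arr (action_cat C G) m1"
    "Dom (action_cat C G) m1 = restrict_action G (in_left G) glued" "Cod (action_cat C G) m1 = A"
    by (rule G.action_iso_if_eq[of "restrict_action G (in_left G) glued" A])
      (use glued_act_push[of "Inl _"] glued_mulc_push[of "Inl _" "Inl _"] in
        \<open>auto simp: left.restrict_action glued_action in_left_eq\<close>)
  obtain m2 where m2: "is_iso_arr (action_cat C H) m2"
    "Dom (action_cat C H) m2 = restrict_action H (in_right H) glued" "Cod (action_cat C H) m2 = B"
    by (rule H.action_iso_if_eq[of "restrict_action H (in_right H) glued" B])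
      (use glued_act_push[of "Inr _"] glued_mulc_push[of "Inr _" "Inr _"] in
        \<open>auto simp: right.restrict_action glued_action in_right_eq\<close>)
  have "glued \<in> Obj (action_cat C P)" by (simp add: action_cat_def glued_action)
  then show ?thesis
    using that[of "(m1, m2)"] m1 m2 prod_cat_iso[OF G.action_cat_category H.action_cat_category]
    by (simp add: prod_cat_def restriction_functor_def)
qed

end

section \<open>Gluing morphisms of actions\<close>

context cat_two_monoids
begin

text \<open>As \<open>mulc\<close> is invertible, compatibility at \<open>(x, w)\<close> determines
  the component at \<open>x # w\<close> from those at the letter \<open>x\<close> and at
  \<open>w\<close>.\<close>

lemma restriction_faithful:
  assumes m [simp]: "is_action_mor C P m" and n [simp]: "is_action_mor C P n"
    and st [simp]: "msrc n = msrc m" "mtgt n = mtgt m"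
    and left: "restrict_action_mor G (in_left G) m = restrict_action_mor G (in_left G) n"
    and right: "restrict_action_mor H (in_right H) m = restrict_action_mor H (in_right H) n"
  shows "m = n"
proof (rule P.action_mor_eqI)
  have letter: "mfam m (push x []) = mfam n (push x [])" if "x \<in> letters" for x
  proof (cases x)
    case (Inl a)
    then show ?thesis
      using that arg_cong[OF left, of "\<lambda>r. mfam r a"] by (simp add: in_left_eq)
  next
    case (Inr b)
    then show ?thesis
      using that arg_cong[OF right, of "\<lambda>r. mfam r b"] by (simp add: in_right_eq)
  qed
  have n' [simp]: "Dom C (mfam n w X) = fobj (act (msrc m) w) X"
    "Cod C (mfam n w X) = fobj (act (mtgt m) w) X" if "w \<in> words" "X \<in> Obj C" for w X
    using that P.dom_mfam[OF n] P.cod_mfam[OF n] by auto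
  fix w X assume "w \<in> carrier P" and [simp]: "X \<in> Obj C"
  then have "w \<in> words" by simp
  then show "mfam m w X = mfam n w X"
  proof (induction w)
    case Nil
    \<comment> \<open>The empty word is the image of the identity of a factor.\<close>
    then show ?case using letter[of "Inl \<one>\<^bsub>G\<^esub>"] by (simp add: push_def)
  next
    case (Cons x w)
    then have [simp]: "x \<in> letters" "w \<in> words" "\<not> letter_one x" "\<not> starts x w" by auto
    have xw: "x # w = push x [] \<otimes>\<^bsub>P\<^esub> w" by (simp add: push_Nil_mult push_not_starts)
    have "mfam m (push x [] \<otimes>\<^bsub>P\<^esub> w) X \<cdot> mulc (msrc m) (push x [], w) X =
      mfam n (push x [] \<otimes>\<^bsub>P\<^esub> w) X \<cdot> mulc (msrc m) (push x [], w) X"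
      using P.mfam_mult[OF m, of "push x []" w X] P.mfam_mult[OF n, of "push x []" w X] Cons
      by (simp add: letter)
    then show ?case
      unfolding xw by (rule iso_cancel_right[rotated -1]) auto
  qed
qed auto

text \<open>Normalisation makes \<open>m1\<close> and \<open>m2\<close> agree at the empty word, the
  common image of both identities. The recursion for \<open>\<phi>\<close> imposes compatibility
  only where a letter precedes a word without merging; the other pairs are reached by
  \<open>compatible_mult\<close>.\<close>

lemma restriction_full:
  assumes S [simp]: "is_action C P S" "P.normalised S" and T [simp]: "is_action C P T" "P.normalised T"
    and m1 [simp]: "is_action_mor C G m1"
    and src1 [simp]: "msrc m1 = restrict_action G (in_left G) S"
    and tgt1 [simp]: "mtgt m1 = restrict_action G (in_left G) T"
    and m2 [simp]: "is_action_mor C H m2"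
    and src2 [simp]: "msrc m2 = restrict_action H (in_right H) S"
    and tgt2 [simp]: "mtgt m2 = restrict_action H (in_right H) T"
  obtains m where "is_action_mor C P m" "msrc m = S" "mtgt m = T"
    "restrict_action_mor G (in_left G) m = m1" "restrict_action_mor H (in_right H) m = m2"
proof -
  note [simp] = P.normalised_act_one[OF S(2), simplified] P.normalised_act_one[OF T(2), simplified]
    P.normalised_mulc_one_left[OF S, simplified] P.normalised_mulc_one_left[OF T, simplified]
    P.normalised_mulc_one_right[OF S, simplified] P.normalised_mulc_one_right[OF T, simplified]
  define ln where "ln = case_sum (mfam m1) (mfam m2)"
  have ln_nat: "is_nat_trans C C (act S (push x [])) (act T (push x [])) (ln x)" if "x \<in> letters" for x
    using that G.mfam_nat[OF m1] H.mfam_nat[OF m2]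
    by (cases x) (auto simp: ln_def in_left_eq in_right_eq)
  note [simp] = nat_trans_arr[OF ln_nat] nat_trans_dom[OF ln_nat] nat_trans_cod[OF ln_nat]
  \<comment> \<open>Restrictions of normalised actions are normalised, so
    \<open>normalised_mfam_one\<close> applies to both \<open>m1\<close> and
    \<open>m2\<close>.\<close>
  have ln_one: "ln x X = Ident C X" if "x \<in> letters" "letter_one x" "X \<in> Obj C" for x X
    using that G.normalised_mfam_one[OF m1] H.normalised_mfam_one[OF m2]
    by (cases x) (auto simp: ln_def left.restrict_normalised right.restrict_normalised)
  \<comment> \<open>Compatibility at \<open>(push x [], w)\<close>, solved for the component at
    \<open>x # w\<close>.\<close>
  define \<phi> where "\<phi> = rec_list (\<lambda>X\<in>Obj C. Ident C X) (\<lambda>x w \<phi>w. \<lambda>X\<in>Obj C.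
    mulc T (push x [], w) X \<cdot> ln x (fobj (act T w) X) \<cdot> farr (act S (push x [])) (\<phi>w X) \<cdot>
    inv_arr C (mulc S (push x [], w) X))"
  have \<phi>_Nil: "\<phi> [] = (\<lambda>X\<in>Obj C. Ident C X)" by (simp add: \<phi>_def)
  have \<phi>_Cons: "\<phi> (x # w) = (\<lambda>X\<in>Obj C. mulc T (push x [], w) X \<cdot> ln x (fobj (act T w) X) \<cdot>
    farr (act S (push x [])) (\<phi> w X) \<cdot> inv_arr C (mulc S (push x [], w) X))" for x w
    by (simp add: \<phi>_def)
  have Cons_eq: "x # w = push x [] \<otimes>\<^bsub>P\<^esub> w" if "x # w \<in> words" for x w
    using that by (simp add: push_Nil_mult push_not_starts)
  have push_eq: "push x [] \<otimes>\<^bsub>P\<^esub> w = x # w" if "x # w \<in> words" for x w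
    using Cons_eq[OF that] by simp
  have \<phi>_nat: "is_nat_trans C C (act S w) (act T w) (\<phi> w)" if "w \<in> words" for w
    using that
  proof (induction w)
    case Nil
    have "\<phi> [] \<in> extensional (Obj C)" unfolding \<phi>_Nil by (rule restrict_extensional)
    then show ?case by (intro nat_transI[of C C _ _ "\<phi> []"]) (simp_all add: \<phi>_Nil)
  next
    case (Cons x w)
    then have [simp]: "x \<in> letters" "w \<in> words" "\<not> letter_one x" "\<not> starts x w" by auto
    have IH: "is_nat_trans C C (act S w) (act T w) (\<phi> w)" using Cons by simp
    have [simp]: "push x [] \<otimes>\<^bsub>P\<^esub> w = x # w" by (rule push_eq) simp
    note [simp] = nat_trans_arr[OF IH] nat_trans_dom[OF IH] nat_trans_cod[OF IH]
    have ext: "\<phi> (x # w) \<in> extensional (Obj C)" unfolding \<phi>_Cons by (rule restrict_extensional)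
    show ?case
    proof (rule nat_transI[OF _ _ ext])
      fix a assume [simp]: "a \<in> Arr C"
      let ?X = "Dom C a" and ?Y = "Cod C a"
      have 1: "mulc S (push x [], w) ?Y \<cdot> farr (act S (push x [])) (farr (act S w) a) =
        farr (act S (x # w)) a \<cdot> mulc S (push x [], w) ?X"
        using P.mulc_natural[OF S(1), of "push x []" w a] by simp
      have 2: "inv_arr C (mulc S (push x [], w) ?Y) \<cdot> farr (act S (x # w)) a =
        farr (act S (push x [])) (farr (act S w) a) \<cdot> inv_arr C (mulc S (push x [], w) ?X)"
        by (rule iso_cancel_left[of "mulc S (push x [], w) ?Y"]) (auto simp: comp_extend[OF 1])
      have 3: "\<phi> w ?Y \<cdot> farr (act S w) a = farr (act T w) a \<cdot> \<phi> w ?X"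
        using nat_trans_natural[OF IH, of a] by simp
      have 4: "farr (act S (push x [])) (\<phi> w ?Y) \<cdot> farr (act S (push x [])) (farr (act S w) a) =
        farr (act S (push x [])) (farr (act T w) a) \<cdot> farr (act S (push x [])) (\<phi> w ?X)"
        using arg_cong[OF 3, of "farr (act S (push x []))"] by simp
      have 5: "ln x (fobj (act T w) ?Y) \<cdot> farr (act S (push x [])) (farr (act T w) a) =
        farr (act T (push x [])) (farr (act T w) a) \<cdot> ln x (fobj (act T w) ?X)"
        using nat_trans_natural[OF ln_nat, of x "farr (act T w) a"] by simp
      have 6: "mulc T (push x [], w) ?Y \<cdot> farr (act T (push x [])) (farr (act T w) a) =
        farr (act T (x # w)) a \<cdot> mulc T (push x [], w) ?X"
        using P.mulc_natural[OF T(1), of "push x []" w a] by simp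
      show "\<phi> (x # w) ?Y \<cdot> farr (act S (x # w)) a = farr (act T (x # w)) a \<cdot> \<phi> (x # w) ?X"
        by (simp add: \<phi>_Cons 2 comp_extend[OF 4] comp_extend[OF 5] comp_extend[OF 6])
    qed (auto simp: \<phi>_Cons)
  qed
  note [simp] = nat_trans_arr[OF \<phi>_nat] nat_trans_dom[OF \<phi>_nat] nat_trans_cod[OF \<phi>_nat]
  \<comment> \<open>For the word \<open>[x]\<close> the recursion contains \<open>mulc\<close> only
    with second entry \<open>[]\<close>, where normalisation makes it an identity.\<close>
  have \<phi>_letter: "\<phi> (push x []) X = ln x X" if [simp]: "x \<in> letters" "X \<in> Obj C" for x X
  proof (cases "letter_one x")
    case True
    then show ?thesis by (simp add: push_def \<phi>_Nil ln_one)
  next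
    case False
    then have p: "push x [] = [x]" by (simp add: push_not_starts starts_def)
    then have [simp]: "[x] \<in> words" using push_words[of x "[]"] by simp
    have [simp]: "Dom C (ln x X) = fobj (act S [x]) X" "Cod C (ln x X) = fobj (act T [x]) X"
      using nat_trans_dom[OF ln_nat, of x X] nat_trans_cod[OF ln_nat, of x X] by (auto simp: p)
    have [simp]: "inv_arr C (Ident C Y) = Ident C Y" if "Y \<in> Obj C" for Y
      using that by (intro inv_arr_unique) auto
    show ?thesis unfolding p by (simp add: \<phi>_Cons p \<phi>_Nil del: Cons_words)
  qed
  let ?K = "P.compatible (act S) (mulc S) T \<phi>"
  have K_Nil: "?K [] w" if "w \<in> words" for w
    using that by (auto simp: P.compatible_def \<phi>_Nil)
  have K_not_starts: "?K (push x []) w" if [simp]: "x \<in> letters" "w \<in> words" "\<not> starts x w" for x w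
  proof (cases "letter_one x")
    case True
    then show ?thesis using K_Nil by (simp add: push_def)
  next
    case False
    then have [simp]: "push x [] \<otimes>\<^bsub>P\<^esub> w = x # w" by (intro push_eq) simp
    show ?thesis using False
      unfolding P.compatible_def by (simp add: \<phi>_Cons \<phi>_letter)
  qed
  have K_same: "?K (push x []) (push y [])"
    if [simp]: "x \<in> letters" "y \<in> letters" "isl x = isl y" for x y
  proof -
    have "ln (lmul x y) X \<cdot> mulc S (push x [], push y []) X =
      mulc T (push x [], push y []) X \<cdot> ln x (fobj (act T (push y [])) X) \<cdot>
        farr (act S (push x [])) (ln y X)" if "X \<in> Obj C" for X
      using that \<open>x \<in> letters\<close> \<open>y \<in> letters\<close> \<open>isl x = isl y\<close>
        G.mfam_mult[OF m1, of "projl x" "projl y" X] H.mfam_mult[OF m2, of "projr x" "projr y" X]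
      by (cases x; cases y) (auto simp: ln_def in_left_eq in_right_eq)
    then show ?thesis
      by (auto simp: P.compatible_def \<phi>_letter simp flip: push_Nil_lmul)
  qed
  have K_push: "?K (push x []) w" if [simp]: "x \<in> letters" "w \<in> words" for x w
  proof -
    obtain y t where [simp]: "y \<in> letters" "isl y = isl x" "t \<in> words" "\<not> starts x t"
      and w: "w = push y t"
      using words_decompose[OF \<open>x \<in> letters\<close> \<open>w \<in> words\<close>] by blast
    have [simp]: "\<not> starts y t" "\<not> starts (lmul x y) t"
      using starts_cong[of y x] starts_cong[of "lmul x y" x] by auto
    \<comment> \<open>In the triple \<open>x\<close>, \<open>y\<close>, \<open>t\<close> the pairs
      \<open>(x, y)\<close>, \<open>(y, t)\<close> and \<open>(x y, t)\<close> are known, the last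
      because \<open>t\<close> does not start in the factor of \<open>x y\<close>; the new pair is
      \<open>(x, y t)\<close>.\<close>
    have "?K (push x [] \<otimes>\<^bsub>P\<^esub> push y []) t \<longleftrightarrow> ?K (push x []) (push y [] \<otimes>\<^bsub>P\<^esub> t)"
      by (rule P.compatible_mult) (auto simp: \<phi>_nat K_same K_not_starts)
    then show ?thesis
      using K_not_starts[of "lmul x y" t] by (simp add: w push_Nil_lmul) (simp add: push_Nil_mult)
  qed
  have K: "?K v w" if "v \<in> words" and [simp]: "w \<in> words" for v w
    using that(1)
  proof (induction v)
    case Nil
    then show ?case by (simp add: K_Nil)
  next
    case (Cons x v)
    then have [simp]: "x \<in> letters" "v \<in> words" by auto
    \<comment> \<open>The other direction: \<open>(x, v)\<close> and \<open>(x, v w)\<close> are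
      instances of \<open>K_push\<close>, \<open>(v, w)\<close> is the induction hypothesis, and
      \<open>(x v, w)\<close> is new.\<close>
    have "?K (push x [] \<otimes>\<^bsub>P\<^esub> v) w \<longleftrightarrow> ?K (push x []) (v \<otimes>\<^bsub>P\<^esub> w)"
      by (rule P.compatible_mult) (use Cons in \<open>auto simp: \<phi>_nat K_push\<close>)
    then show ?case unfolding Cons_eq[OF Cons.prems] by (simp add: K_push)
  qed
  define m where "m = \<lparr>msrc = S, mtgt = T, mfam = (\<lambda>w\<in>words. \<phi> w)\<rparr>"
  have m: "is_action_mor C P m"
    unfolding P.is_action_mor_iff using K
    by (auto simp: m_def \<phi>_nat \<phi>_Nil P.compatible_def)
  moreover have "restrict_action_mor G (in_left G) m = m1"
    by (rule G.action_mor_eqI)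
      (use left.restrict_action_mor[OF m] \<phi>_letter[of "Inl _"] in
        \<open>auto simp: m_def in_left_eq ln_def\<close>)
  moreover have "restrict_action_mor H (in_right H) m = m2"
    by (rule H.action_mor_eqI)
      (use right.restrict_action_mor[OF m] \<phi>_letter[of "Inr _"] in
        \<open>auto simp: m_def in_right_eq ln_def\<close>)
  ultimately show ?thesis using that[of m] by (simp add: m_def)
qed

lemma restriction_equivalence:
  "is_equivalence (action_cat C P) actions_prod (restriction_functor C G H)"
proof (rule equivalence_criterion[where reps = "{T. is_action C P T \<and> P.normalised T}"])
  fix X assume "X \<in> Obj (action_cat C P)"
  then have "is_action C P X" by (simp add: action_cat_def)
  then obtain X0 i where "is_action C P X0" "P.normalised X0" "is_iso_arr (action_cat C P) i"
    "Dom (action_cat C P) i = X0" "Cod (action_cat C P) i = X"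
    using P.normalisation by blast
  then show "\<exists>X0\<in>{T. is_action C P T \<and> P.normalised T}. \<exists>i. is_iso_arr (action_cat C P) i \<and>
    Dom (action_cat C P) i = X0 \<and> Cod (action_cat C P) i = X"
    by blast
next
  fix S T b
  assume ST: "S \<in> {T. is_action C P T \<and> P.normalised T}" "T \<in> {T. is_action C P T \<and> P.normalised T}"
    and b: "b \<in> Hom actions_prod (fobj (restriction_functor C G H) S)
      (fobj (restriction_functor C G H) T)"
  obtain m1 m2 where b_eq: "b = (m1, m2)" by (rule prod.exhaust[of b])
  then have "is_action_mor C G m1" "msrc m1 = restrict_action G (in_left G) S"
    "mtgt m1 = restrict_action G (in_left G) T" "is_action_mor C H m2"
    "msrc m2 = restrict_action H (in_right H) S" "mtgt m2 = restrict_action H (in_right H) T"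
    using b ST by (auto simp: Hom_def restriction_functor_def prod_cat_def action_cat_def)
  then obtain m where m: "is_action_mor C P m" "msrc m = S" "mtgt m = T"
    "restrict_action_mor G (in_left G) m = m1" "restrict_action_mor H (in_right H) m = m2"
    using ST restriction_full by blast
  show "\<exists>a\<in>Hom (action_cat C P) S T. farr (restriction_functor C G H) a = b"
    by (rule bexI[of _ m]) (use m b_eq in \<open>auto simp: Hom_def restriction_functor_def action_cat_def\<close>)
next
  fix S T m n
  assume "m \<in> Hom (action_cat C P) S T" "n \<in> Hom (action_cat C P) S T"
    "farr (restriction_functor C G H) m = farr (restriction_functor C G H) n"
  then show "m = n"
    by (intro restriction_faithful) (auto simp: Hom_def restriction_functor_def action_cat_def)
next
  fix Y assume "Y \<in> Obj actions_prod"
  then obtain A B where Y: "Y = (A, B)" and AB: "is_action C G A" "is_action C H B"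
    by (auto simp: prod_cat_def action_cat_def)
  interpret R: category actions_prod by (simp add: category_def actions_prod_category)
  obtain A' i where A': "is_action C G A'" "G.normalised A'" "is_iso_arr (action_cat C G) i"
    "Dom (action_cat C G) i = A'" "Cod (action_cat C G) i = A"
    using G.normalisation[OF AB(1)] by blast
  obtain B' j where B': "is_action C H B'" "H.normalised B'" "is_iso_arr (action_cat C H) j"
    "Dom (action_cat C H) j = B'" "Cod (action_cat C H) j = B"
    using H.normalisation[OF AB(2)] by blast
  \<comment> \<open>The two components are normalised separately; \<open>(i, j)\<close> then leads
    from the pair isomorphic to the restricted glued action back to \<open>Y\<close>.\<close>
  interpret N: normalised_pair C G H A' B'
    by unfold_locales (use A' B' in auto)
  obtain m where m: "is_iso_arr actions_prod m"
    "Dom actions_prod m = fobj (restriction_functor C G H) N.glued" "Cod actions_prod m = (A', B')"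
    using N.glued_iso by blast
  have ij: "is_iso_arr actions_prod (i, j)" "Dom actions_prod (i, j) = (A', B')"
    "Cod actions_prod (i, j) = Y"
    using A' B' Y prod_cat_iso[OF G.action_cat_category H.action_cat_category]
    by (auto simp: prod_cat_def)
  show "\<exists>X\<in>Obj (action_cat C P). \<exists>e. is_iso_arr actions_prod e \<and>
    Dom actions_prod e = fobj (restriction_functor C G H) X \<and> Cod actions_prod e = Y"
    using m ij
    by (intro bexI[of _ N.glued] exI[of _ "R.cmp (i, j) m"])
      (auto, simp add: action_cat_def N.glued_action)
qed (rule restriction_functor)

end

theorem lemma3p5:
  fixes C :: "('o, 'm) cat"
    and G1 :: "('a, 'x) monoid_scheme"
    and G2 :: "('b, 'y) monoid_scheme"
  assumes "is_category C" and "monoid G1" and "monoid G2"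
  shows "is_equivalence (action_cat C (free_prod G1 G2))
           (prod_cat (action_cat C G1) (action_cat C G2))
           (restriction_functor C G1 G2)"
proof -
  interpret cat_two_monoids C G1 G2
    using assms by (simp add: cat_two_monoids_def category_def two_monoids_def)
  show ?thesis by (rule restriction_equivalence)
qed

end
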